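(* Let $\rho$ be the boundary cut-off function and $\check\Xi^+(\tau,z)$ the boundary $q$-series defined in the context. There exists a non-holomorphic modular form $f_\rho(\tau)$ of weight $2$ for $\mathrm{SL}_2(\mathbb Z)$ such that $$f_\rho(\tau)=\int_X\rho(z)\,\check\Xi^+(\tau,z)\,c_1(\overline{\mathcal L})^2 .$$
   Context: A non-holomorphic modular form of weight $2$ for $\mathrm{SL}_2(\mathbb Z)$ is a (not necessarily holomorphic) function $f$ on the upper half-plane $\mathbb H$ with $f(\frac{a\tau+b}{c\tau+d})=(c\tau+d)^2f(\tau)$ for all $\begin{pmatrix}a&b\\c&d\end{pmatrix}\in\mathrm{SL}_2(\mathbb Z)$. Write $\tau=u+iv\in\mathbb H$, $q=e^{2\pi i\tau}$. $X=X(1)\times X(1)$ is the product of two copies of the compactified modular curve $X(1)\supset\Gamma\backslash\mathbb H$, $\Gamma=\mathrm{SL}_2(\mathbb Z)$, with boundary $D=X\setminus(\Gamma\backslash\mathbb H)^2$. Coordinates: $z=(z_1,z_2)$, $z_j=x_j+iy_j\in\mathbb H$. $\overline{\mathcal L}$ is the line bundle of modular forms of bi-weight $(12,12)$ with Petersson metric, and $$c_1(\overline{\mathcal L})^2=\frac{18}{\pi^2}\,\frac{dx_1dy_1}{y_1^2}\frac{dx_2dy_2}{y_2^2}.$$ $\rho:X(\mathbb C)\to[0,1]$ is a smooth function (partition of unity with respect to $D$) equal to $1$ near $D$ and supported in a neighbourhood of $D$. With $t=\sqrt{y_1y_2}$, $s=\sqrt{y_1/y_2}$ and $b,c\in\mathbb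 Z$ put $$\check\xi(v,z;b,c)=\frac{t}{\sqrt v}\big(B(v,s;b,c)-I(v,s;b,c)\big),\quad B(v,s;b,c)=\int_1^\infty e^{-\pi v(b/s+cs)^2r}r^{-3/2}dr,$$ $I(v,s;b,c)=4\pi\sqrt v\,\min(|b/s|,|cs|)$ if $-bc>0$ and $I(v,s;b,c)=0$ if $-bc\le 0$. Put $\check\Xi(v,z,m)=\frac12\sum_{b,c\in\mathbb Z,\,-bc=m}\check\xi(v,z;b,c)$ and $$\check\Xi^+(\tau,z)=\sum_{m\in\mathbb Z}\check\Xi(v,z,m)q^m-\frac1{2v}\,t\,(s+1/s).$$ Under the integral, $y_1,y_2$ are taken for the representatives of $z_1,z_2$ in the standard fundamental domain of $\Gamma$. It is known (and may be assumed) that for fixed $z$ the function $\tau\mapsto\check\Xi^+(\tau,z)$ is a non-holomorphic modular form of weight $2$ for $\mathrm{SL}_2(\mathbb Z)$. *)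

theory Defs
  imports "HOL-Analysis.Analysis"
begin

definition upper_half_plane :: "complex set" where
  "upper_half_plane = {z. Im z > 0}"

definition nonhol_modular_form :: "nat \<Rightarrow> (complex \<Rightarrow> complex) \<Rightarrow> bool" where
  "nonhol_modular_form k f \<longleftrightarrow>
     (\<forall>a b c d :: int. a * d - b * c = 1 \<longrightarrow>
        (\<forall>\<tau>\<in>upper_half_plane.
           f ((of_int a * \<tau> + of_int b) / (of_int c * \<tau> + of_int d))
             = (of_int c * \<tau> + of_int d) ^ k * f \<tau>))"

subsection \<open>The compactified modular curve\<close>

definition SL2Z_orbit :: "complex \<Rightarrow> complex set" where
  "SL2Z_orbit z =
     {(of_int a * z + of_int b) / (of_int c * z + of_int d) | a b c d :: int. a * d - b * c = 1}"

text \<open>The points of $X(1)$ are the orbits in the upper half-plane and the single cusp, i.e. the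
  class of the rational numbers and infinity, which form one orbit.\<close>

datatype modular_point = Cusp | Orbit "complex set"

definition proj1 :: "complex \<Rightarrow> modular_point" where
  "proj1 z = Orbit (SL2Z_orbit z)"

definition X1_points :: "modular_point set" where
  "X1_points = insert Cusp (proj1 ` upper_half_plane)"

text \<open>The quotient topology; the sets of points with imaginary part greater than \<open>Y\<close> are the
  punctured neighbourhoods of the cusp.\<close>

definition X1_open :: "modular_point set \<Rightarrow> bool" where
  "X1_open U \<longleftrightarrow> U \<subseteq> X1_points \<and> open {z \<in> upper_half_plane. proj1 z \<in> U} \<and>
     (Cusp \<in> U \<longrightarrow> (\<exists>Y>0. \<forall>z. Im z > Y \<longrightarrow> proj1 z \<in> U))"

definition X1 :: "modular_point topology" where
  "X1 = topology X1_open"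

lemma istopology_X1_open: "istopology X1_open"
  unfolding istopology_def
proof (intro conjI allI impI)
  fix S T assume S: "X1_open S" and T: "X1_open T"
  have eq: "{z \<in> upper_half_plane. proj1 z \<in> S \<inter> T}
      = {z \<in> upper_half_plane. proj1 z \<in> S} \<inter> {z \<in> upper_half_plane. proj1 z \<in> T}"
    by auto
  have "\<exists>Y>0. \<forall>z. Im z > Y \<longrightarrow> proj1 z \<in> S \<inter> T" if cusp: "Cusp \<in> S \<inter> T"
  proof -
    obtain Y where Y: "Y > 0" "\<forall>z. Im z > Y \<longrightarrow> proj1 z \<in> S"
      using S cusp unfolding X1_open_def by auto
    obtain Y' where Y': "Y' > 0" "\<forall>z. Im z > Y' \<longrightarrow> proj1 z \<in> T"
      using T cusp unfolding X1_open_def by auto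
    show ?thesis using Y Y' by (intro exI[of _ "max Y Y'"]) auto
  qed
  then show "X1_open (S \<inter> T)"
    using S T unfolding X1_open_def eq by (auto intro!: open_Int)
next
  fix K assume K: "\<forall>S\<in>K. X1_open S"
  have eq: "{z \<in> upper_half_plane. proj1 z \<in> \<Union>K}
      = (\<Union>S\<in>K. {z \<in> upper_half_plane. proj1 z \<in> S})"
    by auto
  have "\<exists>Y>0. \<forall>z. Im z > Y \<longrightarrow> proj1 z \<in> \<Union>K" if cusp: "Cusp \<in> \<Union>K"
  proof -
    obtain S where S: "S \<in> K" "Cusp \<in> S" using cusp by auto
    obtain Y where "Y > 0" "\<forall>z. Im z > Y \<longrightarrow> proj1 z \<in> S"
      using K S unfolding X1_open_def by auto
    then show ?thesis using S by blast
  qed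
  moreover have "open {z \<in> upper_half_plane. proj1 z \<in> \<Union>K}"
    unfolding eq using K by (auto simp: X1_open_def)
  moreover have "\<Union>K \<subseteq> X1_points" using K by (auto simp: X1_open_def)
  ultimately show "X1_open (\<Union>K)" unfolding X1_open_def by blast
qed

lemma openin_X1: "openin X1 U \<longleftrightarrow> X1_open U"
  unfolding X1_def using topology_inverse'[OF istopology_X1_open] by simp

lemma topspace_X1: "topspace X1 = X1_points"
proof -
  have eq: "{z \<in> upper_half_plane. proj1 z \<in> X1_points} = {z. Im z > 0}"
    by (auto simp: X1_points_def upper_half_plane_def)
  have "X1_open X1_points"
    unfolding X1_open_def eq
    by (auto simp: open_halfspace_Im_gt X1_points_def upper_half_plane_def intro!: exI[of _ 1])
  then have "X1_points \<subseteq> topspace X1"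
    by (simp add: openin_X1 openin_subset)
  moreover have "topspace X1 \<subseteq> X1_points"
    using openin_topspace[of X1] unfolding openin_X1 X1_open_def by blast
  ultimately show ?thesis by blast
qed

definition X :: "(modular_point \<times> modular_point) topology" where
  "X = prod_topology X1 X1"

definition D :: "(modular_point \<times> modular_point) set" where
  "D = topspace X - (proj1 ` upper_half_plane) \<times> (proj1 ` upper_half_plane)"

definition proj :: "complex \<times> complex \<Rightarrow> modular_point \<times> modular_point" where
  "proj z = (proj1 (fst z), proj1 (snd z))"

subsection \<open>Smooth functions\<close>

fun Ck_on :: "nat \<Rightarrow> 'a::euclidean_space set \<Rightarrow> ('a \<Rightarrow> 'b::real_normed_vector) \<Rightarrow> bool" where
  "Ck_on 0 S f \<longleftrightarrow> continuous_on S f"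
| "Ck_on (Suc k) S f \<longleftrightarrow>
     (\<forall>x\<in>S. f differentiable (at x)) \<and> (\<forall>h. Ck_on k S (\<lambda>x. frechet_derivative f (at x) h))"

text \<open>Only used for open \<open>S\<close>.\<close>

definition smooth_on :: "'a::euclidean_space set \<Rightarrow> ('a \<Rightarrow> 'b::real_normed_vector) \<Rightarrow> bool" where
  "smooth_on S f \<longleftrightarrow> (\<forall>k. Ck_on k S f)"

text \<open>The order of the stabiliser in $\mathrm{PSL}_2(\mathbb Z)$; each of its elements is
  represented by two matrices.\<close>

definition stab_order :: "complex \<Rightarrow> nat" where
  "stab_order z = card {(a :: int, b :: int, c :: int, d :: int).
     a * d - b * c = 1 \<and>
     (of_int a * z + of_int b) / (of_int c * z + of_int d) = z} div 2"

text \<open>The complex structure of $X(1)$, given by the usual local coordinates: $e^{2\pi i z}$ at the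
  cusp (\<open>None\<close>), and $((z - z_0)/(z - \bar z_0))^n$ with $n$ the order of the stabiliser at the
  class of $z_0$ (\<open>Some z\<^sub>0\<close>). The set consists of the pairs of a point and its coordinate; its
  restriction to small coordinates is the graph of a chart.\<close>

fun local_coord :: "complex option \<Rightarrow> (modular_point \<times> complex) set" where
  "local_coord None =
     insert (Cusp, 0) {(proj1 z, exp (2 * pi * \<i> * z)) | z. z \<in> upper_half_plane}"
| "local_coord (Some z0) =
     {(proj1 z, ((z - z0) / (z - cnj z0)) ^ stab_order z0) | z. z \<in> upper_half_plane}"

definition smooth_on_X :: "(modular_point \<times> modular_point \<Rightarrow> real) \<Rightarrow> bool" where
  "smooth_on_X \<rho> \<longleftrightarrow>
     (\<forall>\<kappa>1 \<in> insert None (Some ` upper_half_plane). \<forall>\<kappa>2 \<in> insert None (Some ` upper_half_plane).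
        \<exists>\<epsilon>>0. \<exists>g. smooth_on (ball 0 \<epsilon> \<times> ball 0 \<epsilon>) g \<and>
          (\<forall>(p1, w1) \<in> local_coord \<kappa>1. \<forall>(p2, w2) \<in> local_coord \<kappa>2.
             norm w1 < \<epsilon> \<longrightarrow> norm w2 < \<epsilon> \<longrightarrow> \<rho> (p1, p2) = g (w1, w2)))"

subsection \<open>Integration over $X$\<close>

definition fundamental_domain :: "complex set" where
  "fundamental_domain = {z \<in> upper_half_plane. \<bar>Re z\<bar> \<le> 1 / 2 \<and> norm z \<ge> 1}"

text \<open>The measure $c_1(\overline{\mathcal L})^2$ on $X \setminus D$ (whose complement \<open>D\<close> is a null
  set), transported to the product of the fundamental domains.\<close>

definition c1_L_squared :: "(complex \<times> complex) measure" where
  "c1_L_squared =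
     density (restrict_space lborel (fundamental_domain \<times> fundamental_domain))
       (\<lambda>(z1, z2). ennreal (18 / pi\<^sup>2 * (1 / (Im z1)\<^sup>2) * (1 / (Im z2)\<^sup>2)))"

subsection \<open>The boundary $q$-series\<close>

definition t_coord :: "complex \<times> complex \<Rightarrow> real" where
  "t_coord z = sqrt (Im (fst z) * Im (snd z))"

definition s_coord :: "complex \<times> complex \<Rightarrow> real" where
  "s_coord z = sqrt (Im (fst z) / Im (snd z))"

definition B_fun :: "real \<Rightarrow> real \<Rightarrow> int \<Rightarrow> int \<Rightarrow> real" where
  "B_fun v s b c =
     (LBINT r:{1..}. exp (- pi * v * (of_int b / s + of_int c * s)\<^sup>2 * r) * r powr (- 3 / 2))"

definition I_fun :: "real \<Rightarrow> real \<Rightarrow> int \<Rightarrow> int \<Rightarrow> real" where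
  "I_fun v s b c =
     (if - b * c > 0 then 4 * pi * sqrt v * min \<bar>of_int b / s\<bar> \<bar>of_int c * s\<bar> else 0)"

definition xi_check :: "real \<Rightarrow> complex \<times> complex \<Rightarrow> int \<Rightarrow> int \<Rightarrow> real" where
  "xi_check v z b c =
     t_coord z / sqrt v * (B_fun v (s_coord z) b c - I_fun v (s_coord z) b c)"

definition Xi_check :: "real \<Rightarrow> complex \<times> complex \<Rightarrow> int \<Rightarrow> real" where
  "Xi_check v z m = 1 / 2 * (\<Sum>\<^sub>\<infinity>(b, c)\<in>{(b, c). - b * c = m}. xi_check v z b c)"

definition Xi_check_plus :: "complex \<Rightarrow> complex \<times> complex \<Rightarrow> complex" where
  "Xi_check_plus \<tau> z =
     (\<Sum>\<^sub>\<infinity>m\<in>UNIV. of_real (Xi_check (Im \<tau>) z m) * exp (2 * pi * \<i> * \<tau>) powi m)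
     - of_real (1 / (2 * Im \<tau>) * t_coord z * (s_coord z + 1 / s_coord z))"

end

theory Submission
  imports Defs "HOL-Probability.Distributions"
begin

text \<open>
  Modularity passes through the integral, because the automorphy factor does not depend on \<open>z\<close>; the
  point is that the integral converges. Estimated term by term the series grows like
  \<open>y\<^sub>1 + y\<^sub>2 = t (s + 1/s)\<close>, which is not integrable. This growth comes from the terms with \<open>bc = 0\<close> only:
  comparing the sum over the nonzero \<open>c\<close> of the decreasing function \<open>B(v, s; 0, c)\<close> with its integral
  \<open>1 / (s \<surd>v)\<close> leaves a bounded error, and likewise for the sum over \<open>b\<close>, so the correction term
  \<open>t (s + 1/s) / (2v)\<close> cancels them up to \<open>O(t)\<close>. For \<open>bc \<noteq> 0\<close>, the factor \<open>q\<^sup>m\<close> with \<open>m = -bc\<close> completes the square: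
  the \<open>B\<close>-part is at most \<open>2 exp(-\<pi>vb\<^sup>2/s\<^sup>2) exp(-\<pi>vc\<^sup>2s\<^sup>2)\<close>, whose double sum is bounded uniformly in \<open>s\<close>,
  and the \<open>I\<close>-part is dominated by a convergent series independent of \<open>s\<close>. Hence the
  integrand is \<open>O(t)\<close> for fixed \<open>\<tau>\<close>, and \<open>t = \<surd>(y\<^sub>1 y\<^sub>2)\<close> is integrable.
\<close>

subsection \<open>The incomplete Gamma kernel\<close>

lemma nn_integral_powr_tail:
  fixes e :: real
  assumes "e < -1"
  shows "(\<integral>\<^sup>+r. ennreal (r powr e) * indicator {1..} r \<partial>lborel) = ennreal (1 / (- e - 1))"
proof -
  have lim: "((\<lambda>x. x powr (e + 1) / (e + 1)) \<longlongrightarrow> 0 / (e + 1)) at_top"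
    using assms by (intro tendsto_intros tendsto_neg_powr filterlim_ident) auto
  have "(\<integral>\<^sup>+r. ennreal (r powr e) * indicator {1..} r \<partial>lborel)
      = ennreal (0 / (e + 1) - 1 powr (e + 1) / (e + 1))"
  proof (rule nn_integral_FTC_atLeast[where F = "\<lambda>x. x powr (e + 1) / (e + 1)"])
    fix x :: real assume "1 \<le> x"
    then show "((\<lambda>x. x powr (e + 1) / (e + 1)) has_real_derivative x powr e) (at x)"
      using assms by (auto intro!: derivative_eq_intros)
  qed (use lim in auto)
  also have "0 / (e + 1) - 1 powr (e + 1) / (e + 1) = 1 / (- e - 1)"
    using assms by (simp add: field_simps)
  finally show ?thesis .
qed

lemma nn_integral_gaussian_half_line:
  fixes a :: real
  assumes "a > 0"
  shows "(\<integral>\<^sup>+x. ennreal (exp (- pi * a * x\<^sup>2)) * indicator {0..} x \<partial>lborel) = ennreal (1 / (2 * sqrt a))"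
proof -
  \<comment> \<open>The scale making \<open>pi * a * c^2 = 1\<close>, which reduces the integral to
    the standard Gaussian moment.\<close>
  define c where "c = 1 / sqrt (pi * a)"
  have c: "c > 0" "pi * a * c\<^sup>2 = 1"
    using assms by (auto simp: c_def power_divide)
  have "(\<integral>\<^sup>+x. ennreal (exp (- pi * a * x\<^sup>2)) * indicator {0..} x \<partial>lborel)
      = \<bar>c\<bar> * (\<integral>\<^sup>+x. ennreal (exp (- pi * a * (0 + c * x)\<^sup>2)) * indicator {0..} (0 + c * x) \<partial>lborel)"
    using c by (intro nn_integral_real_affine) auto
  also have "(\<lambda>x. ennreal (exp (- pi * a * (0 + c * x)\<^sup>2)) * indicator {0..} (0 + c * x))
      = (\<lambda>x. ennreal (indicator {0..} x *\<^sub>R exp (- x\<^sup>2)))"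
  proof
    fix x :: real
    have "- pi * a * (0 + c * x)\<^sup>2 = - (pi * a * c\<^sup>2) * x\<^sup>2"
      by (simp add: power_mult_distrib)
    then have "exp (- pi * a * (0 + c * x)\<^sup>2) = exp (- x\<^sup>2)"
      by (simp only: c) simp
    then show "ennreal (exp (- pi * a * (0 + c * x)\<^sup>2)) * indicator {0..} (0 + c * x)
        = ennreal (indicator {0..} x *\<^sub>R exp (- x\<^sup>2))"
      using c by (auto simp: indicator_def zero_le_mult_iff)
  qed
  also have "(\<integral>\<^sup>+x. ennreal (indicator {0..} x *\<^sub>R exp (- x\<^sup>2)) \<partial>lborel) = ennreal (sqrt pi / 2)"
    using gaussian_moment_0
    by (subst nn_integral_eq_integral) (auto simp: has_bochner_integral_iff)
  also have "ennreal \<bar>c\<bar> * ennreal (sqrt pi / 2) = ennreal (1 / (2 * sqrt a))"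
    using assms by (subst ennreal_mult[symmetric]) (auto simp: c_def real_sqrt_mult)
  finally show ?thesis .
qed

text \<open>For \<open>w > 0\<close> this is \<open>sqrt (pi * w)\<close> times the incomplete Gamma
  value Gamma(-1/2, \<open>pi * w\<close>). Through \<open>w = v * (b / s + c * s)^2\<close> all
  values of \<open>B_fun\<close> come from this one decreasing function.\<close>

definition tail_kernel :: "real \<Rightarrow> real" where
  "tail_kernel w = (LBINT r:{1..}. exp (- pi * w * r) * r powr (- 3 / 2))"

lemma B_fun_eq_tail_kernel: "B_fun v s b c = tail_kernel (v * (of_int b / s + of_int c * s)\<^sup>2)"
  unfolding B_fun_def tail_kernel_def by (simp add: mult.assoc)

lemma set_integrable_powr_tail: "set_integrable lborel {1..} (\<lambda>r::real. r powr (- 3 / 2))"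
proof -
  have "(\<integral>\<^sup>+x. ennreal (norm (indicator {1..} x *\<^sub>R x powr (- 3 / 2 :: real))) \<partial>lborel)
      = (\<integral>\<^sup>+r. ennreal (r powr (- 3 / 2)) * indicator {1..} r \<partial>lborel)"
    by (intro nn_integral_cong) (auto simp: indicator_def)
  then show ?thesis
    unfolding set_integrable_def integrable_iff_bounded
    by (subst (asm) nn_integral_powr_tail) auto
qed

lemma set_lebesgue_integral_powr_tail: "(LBINT r:{1..}. r powr (- 3 / 2)) = (2::real)"
proof -
  have "(LBINT r:{1..}. r powr (- 3 / 2))
      = enn2real (\<integral>\<^sup>+x. ennreal (indicator {1..} x *\<^sub>R x powr (- 3 / 2)) \<partial>lborel)"
    unfolding set_lebesgue_integral_def by (intro integral_eq_nn_integral) auto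
  also have "(\<integral>\<^sup>+x. ennreal (indicator {1..} x *\<^sub>R x powr (- 3 / 2)) \<partial>lborel)
      = (\<integral>\<^sup>+r. ennreal (r powr (- 3 / 2)) * indicator {1..} r \<partial>lborel)"
    by (intro nn_integral_cong) (auto simp: indicator_def)
  also have "\<dots> = ennreal 2"
    by (subst nn_integral_powr_tail) (auto simp del: ennreal_numeral)
  finally show ?thesis by simp
qed

lemma set_integrable_tail_kernel:
  assumes "w \<ge> 0"
  shows "set_integrable lborel {1..} (\<lambda>r. exp (- pi * w * r) * r powr (- 3 / 2))"
  using set_integrable_powr_tail unfolding set_integrable_def
proof (rule Bochner_Integration.integrable_bound)
  show "AE x in lborel. norm (indicator {1..} x *\<^sub>R (exp (- pi * w * x) * x powr (- 3 / 2)))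
      \<le> norm (indicator {1..} x *\<^sub>R x powr (- 3 / 2))"
    using assms by (intro AE_I2) (auto simp: indicator_def intro!: mult_left_le_one_le)
qed auto

lemma tail_kernel_nonneg: "tail_kernel w \<ge> 0"
  unfolding tail_kernel_def set_lebesgue_integral_def by (intro Bochner_Integration.integral_nonneg) auto

lemma tail_kernel_antimono:
  assumes "0 \<le> w" "w \<le> w'"
  shows "tail_kernel w' \<le> tail_kernel w"
  unfolding tail_kernel_def
proof (intro set_integral_mono set_integrable_tail_kernel)
  fix r :: real assume "r \<in> {1..}"
  then have "- pi * w' * r \<le> - pi * w * r"
    using assms by (auto simp: mult_right_mono)
  then show "exp (- pi * w' * r) * r powr (- 3 / 2) \<le> exp (- pi * w * r) * r powr (- 3 / 2)"
    by (intro mult_right_mono) auto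
qed (use assms in auto)

text \<open>For \<open>r \<ge> 1\<close> the exponential is at most its value at
  \<open>r = 1\<close>, and the remaining power integrates to 2. In terms of \<open>b\<close> and
  \<open>c\<close> this is a Gaussian bound.\<close>

lemma tail_kernel_le:
  assumes "0 \<le> w"
  shows "tail_kernel w \<le> 2 * exp (- pi * w)"
proof -
  have "tail_kernel w \<le> (LBINT r:{1..}. exp (- pi * w) * r powr (- 3 / 2))"
    unfolding tail_kernel_def
  proof (intro set_integral_mono set_integrable_tail_kernel set_integrable_mult_right set_integrable_powr_tail)
    fix r :: real assume "r \<in> {1..}"
    then have "- pi * w * r \<le> - pi * w"
      using assms mult_left_mono[of 1 r "pi * w"] by simp
    then show "exp (- pi * w * r) * r powr (- 3 / 2) \<le> exp (- pi * w) * r powr (- 3 / 2)"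
      by (intro mult_right_mono) auto
  qed (use assms in auto)
  then show ?thesis
    using set_lebesgue_integral_powr_tail by simp
qed

lemma tail_kernel_zero: "tail_kernel 0 = 2"
  unfolding tail_kernel_def using set_lebesgue_integral_powr_tail by simp

lemma ennreal_tail_kernel:
  assumes "0 \<le> w"
  shows "ennreal (tail_kernel w)
    = (\<integral>\<^sup>+r. ennreal (exp (- pi * w * r) * r powr (- 3 / 2)) * indicator {1..} r \<partial>lborel)"
proof -
  have "ennreal (tail_kernel w)
      = (\<integral>\<^sup>+r. ennreal (indicator {1..} r *\<^sub>R (exp (- pi * w * r) * r powr (- 3 / 2))) \<partial>lborel)"
    unfolding tail_kernel_def set_lebesgue_integral_def
    using set_integrable_tail_kernel[OF assms] unfolding set_integrable_def
    by (intro nn_integral_eq_integral[symmetric]) auto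
  also have "\<dots> = (\<integral>\<^sup>+r. ennreal (exp (- pi * w * r) * r powr (- 3 / 2)) * indicator {1..} r \<partial>lborel)"
    by (intro nn_integral_cong) (auto simp: indicator_def)
  finally show ?thesis .
qed

text \<open>By Tonelli, integrating over \<open>x\<close> first gives the Gaussian value 1 / (2 sqrt
  r), and half the integral of \<open>r powr (- 2)\<close> remains. The value 1/2 fixes the main
  term \<open>1 / \<alpha>\<close> of the lattice sums below, which is why the correction term of
  \<open>Xi_check_plus\<close> matches their growth exactly.\<close>

lemma nn_integral_tail_kernel:
  "(\<integral>\<^sup>+x. ennreal (tail_kernel (x\<^sup>2)) * indicator {0..} x \<partial>lborel) = ennreal (1 / 2)"
proof -
  have "(\<integral>\<^sup>+x. ennreal (tail_kernel (x\<^sup>2)) * indicator {0..} x \<partial>lborel)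
     = (\<integral>\<^sup>+x. (\<integral>\<^sup>+r. ennreal (exp (- pi * x\<^sup>2 * r) * r powr (- 3 / 2)) * indicator {1..} r * indicator {0..} x \<partial>lborel) \<partial>lborel)"
    by (subst nn_integral_multc) (auto simp: ennreal_tail_kernel)
  also have "\<dots> = (\<integral>\<^sup>+r. (\<integral>\<^sup>+x. ennreal (exp (- pi * x\<^sup>2 * r) * r powr (- 3 / 2)) * indicator {1..} r * indicator {0..} x \<partial>lborel) \<partial>lborel)"
    by (intro lborel_pair.Fubini') measurable
  also have "\<dots> = (\<integral>\<^sup>+r. ennreal (1 / 2) * (ennreal (r powr (- 2)) * indicator {1..} r) \<partial>lborel)"
  proof (intro nn_integral_cong)
    fix r :: real
    show "(\<integral>\<^sup>+x. ennreal (exp (- pi * x\<^sup>2 * r) * r powr (- 3 / 2)) * indicator {1..} r * indicator {0..} x \<partial>lborel)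
        = ennreal (1 / 2) * (ennreal (r powr (- 2)) * indicator {1..} r)"
    proof (cases "r \<ge> 1")
      case True
      have "(\<integral>\<^sup>+x. ennreal (exp (- pi * x\<^sup>2 * r) * r powr (- 3 / 2)) * indicator {1..} r * indicator {0..} x \<partial>lborel)
          = (\<integral>\<^sup>+x. ennreal (r powr (- 3 / 2)) * (ennreal (exp (- pi * r * x\<^sup>2)) * indicator {0..} x) \<partial>lborel)"
        using True by (intro nn_integral_cong) (auto simp: ennreal_mult' mult_ac)
      also have "\<dots> = ennreal (r powr (- 3 / 2)) * ennreal (1 / (2 * sqrt r))"
        using True by (subst nn_integral_cmult) (use nn_integral_gaussian_half_line[of r] in auto)
      also have "\<dots> = ennreal (r powr (- 3 / 2) * (1 / (2 * sqrt r)))"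
        using True by (intro ennreal_mult[symmetric]) auto
      also have "r powr (- 3 / 2) * (1 / (2 * sqrt r)) = 1 / 2 * r powr (- 2)"
      proof -
        have "r powr (- 2) = r powr (- 3 / 2) * r powr (- (1 / 2))"
          by (simp add: powr_add[symmetric])
        then show ?thesis
          using True by (simp add: powr_minus powr_half_sqrt field_simps)
      qed
      also have "ennreal (1 / 2 * r powr (- 2)) = ennreal (1 / 2) * (ennreal (r powr (- 2)) * indicator {1..} r)"
        using True by (subst ennreal_mult) auto
      finally show ?thesis .
    qed auto
  qed
  also have "\<dots> = ennreal (1 / 2) * ennreal 1"
    by (subst nn_integral_cmult) (auto simp: nn_integral_powr_tail simp del: ennreal_1)
  finally show ?thesis by simp
qed

subsection \<open>Lattice sums\<close>

text \<open>On each unit interval a decreasing function lies between its endpoint values. Comparing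
  extended nonnegative integrals makes summability a consequence of the comparison.\<close>

lemma antimono_sum_integral_comparison:
  fixes f :: "real \<Rightarrow> real"
  assumes meas: "f \<in> borel_measurable borel"
    and nonneg: "\<And>x. 0 \<le> f x"
    and anti: "\<And>x y. 0 \<le> x \<Longrightarrow> x \<le> y \<Longrightarrow> f y \<le> f x"
    and int: "(\<integral>\<^sup>+x. ennreal (f x) * indicator {0..} x \<partial>lborel) = ennreal L"
    and L: "0 \<le> L"
  shows "summable (\<lambda>n. f (real n))" "(\<Sum>n. f (real (Suc n))) \<le> L" "L \<le> (\<Sum>n. f (real n))"
proof -
  note [measurable] = meas
  let ?J = "\<lambda>n::nat. {real n..<real n + 1}"
  have disj: "disjoint_family ?J"
    unfolding disjoint_family_on_def
  proof (intro ballI impI)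
    fix m n :: nat assume "m \<noteq> n"
    then have "real m + 1 \<le> real n \<or> real n + 1 \<le> real m"
      by linarith
    then show "?J m \<inter> ?J n = {}" by auto
  qed
  have cover: "(\<Union>n. ?J n) = {0..}"
  proof safe
    fix x :: real assume "0 \<le> x"
    then have "x \<in> ?J (nat \<lfloor>x\<rfloor>)" by auto
    then show "x \<in> (\<Union>n. ?J n)" by blast
  qed auto
  have split: "ennreal L = (\<Sum>n. \<integral>\<^sup>+x. ennreal (f x) * indicator (?J n) x \<partial>lborel)"
    using nn_integral_disjoint_family[of "\<lambda>x. ennreal (f x)" lborel ?J] disj int by (simp add: cover)
  \<comment> \<open>Since \<open>?J n\<close> has length 1, each endpoint value can be written as an
    integral over it and compared pointwise.\<close>
  have unit: "(\<integral>\<^sup>+x. a * indicator (?J n) x \<partial>lborel) = a" for a :: ennreal and n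
    by (simp add: nn_integral_cmult_indicator)
  have lower: "ennreal (f (real (Suc n))) \<le> (\<integral>\<^sup>+x. ennreal (f x) * indicator (?J n) x \<partial>lborel)" for n
    by (rule order_trans[OF eq_refl[OF unit[symmetric]]], rule nn_integral_mono)
      (auto simp: indicator_def intro!: ennreal_leI anti)
  have upper: "(\<integral>\<^sup>+x. ennreal (f x) * indicator (?J n) x \<partial>lborel) \<le> ennreal (f (real n))" for n
    by (rule order_trans[OF _ eq_refl[OF unit]], rule nn_integral_mono)
      (auto simp: indicator_def intro!: ennreal_leI anti)
  have le: "(\<Sum>n. ennreal (f (real (Suc n)))) \<le> ennreal L"
    unfolding split by (intro suminf_le lower) auto
  \<comment> \<open>The comparison with \<open>L\<close> bounds the terms from index 1 on; the term
    at 0 is restored afterwards by the index shift.\<close>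
  have "summable (\<lambda>n. f (real (Suc n)))"
    by (rule summable_suminf_not_top) (use nonneg le in \<open>auto simp: top_unique\<close>)
  then show sm: "summable (\<lambda>n. f (real n))"
    by (subst (asm) summable_Suc_iff)
  have "ennreal (\<Sum>n. f (real (Suc n))) \<le> ennreal L"
    using le nonneg \<open>summable (\<lambda>n. f (real (Suc n)))\<close> by (subst (asm) suminf_ennreal2) auto
  then show "(\<Sum>n. f (real (Suc n))) \<le> L"
    using L by (subst (asm) ennreal_le_iff) auto
  have "ennreal L \<le> (\<Sum>n. ennreal (f (real n)))"
    unfolding split by (intro suminf_le upper) auto
  then have "ennreal L \<le> ennreal (\<Sum>n. f (real n))"
    using nonneg sm by (subst (asm) suminf_ennreal2) auto
  then show "L \<le> (\<Sum>n. f (real n))"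
    using suminf_nonneg[OF sm nonneg] by (subst (asm) ennreal_le_iff) auto
qed

text \<open>Positive and negative integers each contribute the tail from index 1, through
  \<open>n \<mapsto> Suc n\<close> and its negative.\<close>

lemma even_has_sum_int:
  fixes g :: "nat \<Rightarrow> real"
  assumes "summable g" "\<And>n. g n \<ge> 0"
  shows "((\<lambda>c::int. g (nat \<bar>c\<bar>)) has_sum (2 * (\<Sum>n. g (Suc n)))) (- {0})"
proof -
  let ?h = "\<lambda>c::int. g (nat \<bar>c\<bar>)"
  have base: "((\<lambda>n. g (Suc n)) has_sum (\<Sum>n. g (Suc n))) UNIV"
    using assms by (intro sums_nonneg_imp_has_sum summable_sums) (auto simp: summable_Suc_iff)
  have pos: "(?h has_sum (\<Sum>n. g (Suc n))) {0<..}"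
    using base by (rule has_sum_reindex_bij_witness[of _ "\<lambda>c. nat c - 1" "\<lambda>n. int (Suc n)", THEN iffD1, rotated -1]) (auto simp: nat_add_distrib)
  have neg: "(?h has_sum (\<Sum>n. g (Suc n))) {..<0}"
    using base by (rule has_sum_reindex_bij_witness[of _ "\<lambda>c. nat (- c) - 1" "\<lambda>n. - int (Suc n)", THEN iffD1, rotated -1]) (auto simp: nat_add_distrib)
  have "(?h has_sum ((\<Sum>n. g (Suc n)) + (\<Sum>n. g (Suc n)))) ({0<..} \<union> {..<0})"
    using pos neg by (rule has_sum_Un_disjoint) auto
  also have "{0<..} \<union> {..<0} = - {0::int}" by auto
  finally show ?thesis by simp
qed


lemma borel_measurable_tail_kernel [measurable]: "tail_kernel \<in> borel_measurable borel"
  unfolding tail_kernel_def set_lebesgue_integral_def by measurable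

text \<open>After rescaling, the half-line integral is \<open>1 / (2 * \<alpha>)\<close>; the sum
  from index 1 lies below it and the sum from index 0 above it. Doubling gives both bounds, and
  their gap, twice the term at 0, does not depend on \<open>\<alpha>\<close>.\<close>

lemma lattice_sum_approximates_integral:
  fixes f :: "real \<Rightarrow> real"
  assumes meas [measurable]: "f \<in> borel_measurable borel"
    and nonneg: "\<And>x. 0 \<le> f x"
    and anti: "\<And>x y. 0 \<le> x \<Longrightarrow> x \<le> y \<Longrightarrow> f y \<le> f x"
    and int: "(\<integral>\<^sup>+x. ennreal (f x) * indicator {0..} x \<partial>lborel) = ennreal (1 / 2)"
    and \<alpha>: "0 < \<alpha>"
  obtains S where "((\<lambda>c::int. f (\<alpha> * \<bar>of_int c\<bar>)) has_sum S) (- {0})" "S \<le> 1 / \<alpha>" "1 / \<alpha> \<le> S + 2 * f 0"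
proof
  let ?g = "\<lambda>n. f (\<alpha> * real n)"
  let ?S = "2 * (\<Sum>n. ?g (Suc n))"
  have "ennreal (1 / 2) = \<bar>\<alpha>\<bar> * (\<integral>\<^sup>+x. ennreal (f (0 + \<alpha> * x)) * indicator {0..} (0 + \<alpha> * x) \<partial>lborel)"
    unfolding int[symmetric] using \<alpha> by (intro nn_integral_real_affine) auto
  also have "(\<lambda>x. ennreal (f (0 + \<alpha> * x)) * indicator {0..} (0 + \<alpha> * x))
      = (\<lambda>x. ennreal (f (\<alpha> * x)) * indicator {0..} x)"
    using \<alpha> by (auto simp: indicator_def zero_le_mult_iff)
  \<comment> \<open>Multiplying by \<open>1 / \<alpha>\<close> isolates the rescaled integral
    without dividing in the extended reals.\<close>
  finally have "ennreal (1 / \<alpha>) * ennreal (1 / 2)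
      = ennreal (1 / \<alpha>) * (ennreal \<alpha> * (\<integral>\<^sup>+x. ennreal (f (\<alpha> * x)) * indicator {0..} x \<partial>lborel))"
    using \<alpha> by simp
  also have "\<dots> = (ennreal (1 / \<alpha>) * ennreal \<alpha>) * (\<integral>\<^sup>+x. ennreal (f (\<alpha> * x)) * indicator {0..} x \<partial>lborel)"
    by (simp only: mult.assoc)
  also have "ennreal (1 / \<alpha>) * ennreal \<alpha> = 1"
    using \<alpha> by (subst ennreal_mult[symmetric]) auto
  also have "ennreal (1 / \<alpha>) * ennreal (1 / 2) = ennreal (1 / (2 * \<alpha>))"
    using \<alpha> by (subst ennreal_mult[symmetric]) auto
  finally have scaled: "(\<integral>\<^sup>+x. ennreal (f (\<alpha> * x)) * indicator {0..} x \<partial>lborel) = ennreal (1 / (2 * \<alpha>))"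
    by simp
  have cmp: "summable ?g" "(\<Sum>n. ?g (Suc n)) \<le> 1 / (2 * \<alpha>)" "1 / (2 * \<alpha>) \<le> (\<Sum>n. ?g n)"
    using antimono_sum_integral_comparison[of "\<lambda>x. f (\<alpha> * x)", OF _ _ _ scaled] \<alpha>
    by (auto simp: nonneg anti)
  have "((\<lambda>c::int. ?g (nat \<bar>c\<bar>)) has_sum ?S) (- {0})"
    by (intro even_has_sum_int cmp nonneg)
  then show "((\<lambda>c::int. f (\<alpha> * \<bar>of_int c\<bar>)) has_sum ?S) (- {0})"
    by simp
  show "?S \<le> 1 / \<alpha>"
    using cmp(2) \<alpha> by (simp add: field_simps)
  have "(\<Sum>n. ?g n) = f 0 + (\<Sum>n. ?g (Suc n))"
    using suminf_split_head[OF cmp(1)] by simp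
  then show "1 / \<alpha> \<le> ?S + 2 * f 0"
    using cmp(3) \<alpha> by (simp add: field_simps)
qed

text \<open>For the spacings \<open>sqrt v / s\<close> and \<open>sqrt v * s\<close> that occur
  below, the product of the two bounds \<open>1 / \<alpha>\<close> is \<open>1 / v\<close>, free of
  \<open>s\<close>.\<close>

lemma gaussian_lattice_sum:
  fixes \<alpha> :: real
  assumes "0 < \<alpha>"
  obtains S where "((\<lambda>c::int. exp (- pi * (\<alpha> * of_int c)\<^sup>2)) has_sum S) (- {0})" "S \<le> 1 / \<alpha>"
proof -
  obtain S where "((\<lambda>c::int. exp (- pi * (\<alpha> * \<bar>of_int c\<bar>)\<^sup>2)) has_sum S) (- {0})" "S \<le> 1 / \<alpha>"
  proof (rule lattice_sum_approximates_integral[where f = "\<lambda>x. exp (- pi * x\<^sup>2)"])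
    show "(\<integral>\<^sup>+x. ennreal (exp (- pi * x\<^sup>2)) * indicator {0..} x \<partial>lborel) = ennreal (1 / 2)"
      using nn_integral_gaussian_half_line[of 1] by simp
  qed (use assms in \<open>auto intro: power_mono\<close>)
  then show thesis
    using that by (simp add: power_mult_distrib)
qed

text \<open>The error 4 is twice \<open>tail_kernel 0 = 2\<close>. Being independent of
  \<open>\<alpha>\<close>, it stays bounded however large or small \<open>s\<close> becomes.\<close>

lemma tail_kernel_lattice_sum:
  fixes \<alpha> :: real
  assumes "0 < \<alpha>"
  obtains S where "((\<lambda>c::int. tail_kernel ((\<alpha> * of_int c)\<^sup>2)) has_sum S) (- {0})" "\<bar>S - 1 / \<alpha>\<bar> \<le> 4"
proof -
  obtain S where "((\<lambda>c::int. tail_kernel ((\<alpha> * \<bar>of_int c\<bar>)\<^sup>2)) has_sum S) (- {0})"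
    "S \<le> 1 / \<alpha>" "1 / \<alpha> \<le> S + 2 * tail_kernel (0\<^sup>2)"
    by (rule lattice_sum_approximates_integral[where f = "\<lambda>x. tail_kernel (x\<^sup>2)"])
      (use assms in \<open>auto intro!: power_mono tail_kernel_antimono simp: tail_kernel_nonneg nn_integral_tail_kernel
         simp del: ennreal_half\<close>)
  then show thesis
    using that by (simp add: power_mult_distrib tail_kernel_zero)
qed

text \<open>Summing over \<open>B\<close> and then over \<open>A\<close> gives the value;
  nonnegativity upgrades convergence of the iterated sum to summability over the product.\<close>

lemma has_sum_times_real:
  fixes f :: "'a \<Rightarrow> real" and g :: "'b \<Rightarrow> real"
  assumes f: "(f has_sum S) A" and g: "(g has_sum T) B"
    and "\<And>a. a \<in> A \<Longrightarrow> f a \<ge> 0" "\<And>b. b \<in> B \<Longrightarrow> g b \<ge> 0"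
  shows "((\<lambda>(a, b). f a * g b) has_sum (S * T)) (A \<times> B)"
proof -
  have inner: "((\<lambda>b. case (a, b) of (a, b) \<Rightarrow> f a * g b) has_sum (f a * T)) B" for a
    using has_sum_cmult_right[OF g] by simp
  have outer: "((\<lambda>a. f a * T) has_sum (S * T)) A"
    by (rule has_sum_cmult_left[OF f])
  show ?thesis
    by (rule has_sum_SigmaI[OF inner outer], rule summable_on_SigmaI[OF inner])
      (use assms outer in \<open>auto simp: summable_on_def\<close>)
qed

text \<open>This is the differentiated geometric series with ratio \<open>exp (- a)\<close>, taken
  over both signs of \<open>c\<close>.\<close>

lemma summable_on_abs_exp_int:
  fixes a :: real
  assumes "a > 0"
  shows "(\<lambda>c::int. \<bar>of_int c\<bar> * exp (- a * \<bar>of_int c\<bar>)) summable_on (- {0})"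
proof -
  have "summable (\<lambda>n. of_nat n * exp (- a) ^ n)"
  proof (subst summable_Suc_iff[symmetric])
    \<comment> \<open>The derivative series has terms (n + 1) x^n; one more factor
      \<open>x = exp (- a)\<close> turns them into the shifted terms wanted.\<close>
    have "summable (\<lambda>n. of_nat (Suc n) * exp (- a) ^ n)"
      using geometric_deriv_sums[of "exp (- a)"] assms by (auto simp: sums_iff)
    then have "summable (\<lambda>n. exp (- a) * (of_nat (Suc n) * exp (- a) ^ n))"
      by (rule summable_mult)
    then show "summable (\<lambda>n. of_nat (Suc n) * exp (- a) ^ Suc n)"
      by (simp add: mult_ac)
  qed
  then have "summable (\<lambda>n. real n * exp (- a * real n))"
    by (simp add: exp_of_nat_mult[symmetric] mult_ac)
  from even_has_sum_int[OF this] show ?thesis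
    by (auto simp: summable_on_def)
qed

subsection \<open>Bounds for the boundary series\<close>

lemma norm_q_powi: "norm (exp (2 * pi * \<i> * \<tau>) powi m) = exp (- 2 * pi * Im \<tau> * of_int m)"
  by (simp add: exp_power_int mult_ac)

text \<open>The cross term is what |q^m| = exp (2 pi v b c), with \<open>m = - b * c\<close>,
  cancels after multiplication by -pi; a product of two Gaussians remains.\<close>

lemma scaled_square_expand:
  fixes v s :: real and b c :: int
  assumes "v > 0" "s > 0"
  shows "v * (of_int b / s + of_int c * s)\<^sup>2
    = (sqrt v / s * of_int b)\<^sup>2 + (sqrt v * s * of_int c)\<^sup>2 + 2 * v * (of_int b * of_int c)"
  using assms by (simp add: power2_eq_square field_simps)

lemma I_fun_nonneg: "v > 0 \<Longrightarrow> I_fun v s b c \<ge> 0"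
  by (auto simp: I_fun_def)

text \<open>The two arguments of the minimum have product \<open>\<bar>b * c\<bar>\<close>, which is
  at least 1 when \<open>- b * c > 0\<close>. A minimum up to 1 is thus below the product; a larger
  one means that both factors exceed 1, so again it is below. The bound is free of
  \<open>s\<close>.\<close>

lemma I_fun_le:
  assumes "v > 0" "s > 0"
  shows "I_fun v s b c \<le> 4 * pi * sqrt v * \<bar>of_int b * of_int c\<bar>"
proof (cases "- b * c > 0")
  case True
  then have nz: "b \<noteq> 0" "c \<noteq> 0" by auto
  let ?x = "\<bar>of_int b / s\<bar>" and ?y = "\<bar>of_int c * s\<bar>"
  have xy: "?x * ?y = \<bar>real_of_int b * of_int c\<bar>"
    using assms by (simp add: abs_mult)
  have "1 \<le> \<bar>b * c\<bar>" using nz by (auto simp: abs_mult) (smt (verit) mult_pos_pos zero_less_abs_iff)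
  then have one: "1 \<le> \<bar>real_of_int b * of_int c\<bar>"
    by (metis of_int_1_le_iff of_int_abs of_int_mult)
  have "min ?x ?y \<le> \<bar>real_of_int b * of_int c\<bar>"
  proof (cases "min ?x ?y \<le> 1")
    case False
    then have "?x \<le> ?x * ?y" using mult_left_mono[of 1 ?y ?x] by auto
    then show ?thesis unfolding xy by (rule min.coboundedI1)
  qed (use one in linarith)
  then show ?thesis
    unfolding I_fun_def using assms True by (auto intro!: mult_left_mono)
qed (use assms in \<open>auto simp: I_fun_def\<close>)

text \<open>For negative \<open>m = - b * c\<close> the power q^m grows, but \<open>I_fun\<close>
  vanishes and the cross term in the bound for \<open>B_fun\<close> absorbs the growth. For positive
  \<open>m\<close> the decay of q^m controls \<open>I_fun\<close>.\<close>

lemma norm_boundary_term_le: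
  assumes \<tau>: "Im \<tau> > 0" and z: "z \<in> upper_half_plane \<times> upper_half_plane"
    and nz: "b \<noteq> 0" "c \<noteq> 0"
  defines "v \<equiv> Im \<tau>" and "s \<equiv> s_coord z"
  shows "norm (of_real (xi_check v z b c) * exp (2 * pi * \<i> * \<tau>) powi (- b * c))
    \<le> t_coord z / sqrt v *
       (2 * (exp (- pi * (sqrt v / s * of_int b)\<^sup>2) * exp (- pi * (sqrt v * s * of_int c)\<^sup>2))
        + 4 * pi * sqrt v * ((\<bar>of_int b\<bar> * exp (- (pi * v) * \<bar>of_int b\<bar>)) * (\<bar>of_int c\<bar> * exp (- (pi * v) * \<bar>of_int c\<bar>))))"
proof -
  have v: "v > 0" and s: "s > 0" and t: "t_coord z > 0"
    using \<tau> z by (auto simp: v_def s_def s_coord_def t_coord_def upper_half_plane_def)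
  let ?e = "exp (2 * pi * v * (of_int b * of_int c))"
  have q: "norm (exp (2 * pi * \<i> * \<tau>) powi (- b * c)) = ?e"
    unfolding norm_q_powi by (simp add: v_def mult_ac)
  have "B_fun v s b c * ?e \<le> 2 * exp (- pi * (v * (of_int b / s + of_int c * s)\<^sup>2)) * ?e"
    unfolding B_fun_eq_tail_kernel using v by (intro mult_right_mono tail_kernel_le) auto
  also have "\<dots> = 2 * (exp (- pi * (sqrt v / s * of_int b)\<^sup>2) * exp (- pi * (sqrt v * s * of_int c)\<^sup>2))"
    unfolding scaled_square_expand[OF v s] by (simp add: exp_add[symmetric] algebra_simps)
  finally have B: "B_fun v s b c * ?e
      \<le> 2 * (exp (- pi * (sqrt v / s * of_int b)\<^sup>2) * exp (- pi * (sqrt v * s * of_int c)\<^sup>2))" .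
  have I: "I_fun v s b c * ?e \<le> 4 * pi * sqrt v * ((\<bar>of_int b\<bar> * exp (- (pi * v) * \<bar>of_int b\<bar>)) * (\<bar>of_int c\<bar> * exp (- (pi * v) * \<bar>of_int c\<bar>)))"
  proof (cases "- b * c > 0")
    case True
    \<comment> \<open>As \<open>\<bar>b\<bar>\<close> and \<open>\<bar>c\<bar>\<close> are at least
      1, their product bounds each of them. This splits the exponential in \<open>b * c\<close> into
      a factor in \<open>b\<close> and a factor in \<open>c\<close>.\<close>
    have "\<bar>b\<bar> + \<bar>c\<bar> \<le> 2 * (- (b * c))"
    proof -
      have "- (b * c) = \<bar>b\<bar> * \<bar>c\<bar>"
        using True by (simp add: abs_mult[symmetric])
      moreover have "\<bar>b\<bar> * 1 \<le> \<bar>b\<bar> * \<bar>c\<bar>" "1 * \<bar>c\<bar> \<le> \<bar>b\<bar> * \<bar>c\<bar>"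
        using nz by (intro mult_left_mono mult_right_mono; simp)+
      ultimately show ?thesis by linarith
    qed
    then have "real_of_int (\<bar>b\<bar> + \<bar>c\<bar>) \<le> real_of_int (2 * (- (b * c)))"
      by (simp only: of_int_le_iff)
    then have "pi * v * (\<bar>of_int b\<bar> + \<bar>of_int c\<bar>) \<le> pi * v * (2 * (- (of_int b * of_int c)))"
      using v by (intro mult_left_mono) auto
    then have "?e \<le> exp (- (pi * v) * \<bar>of_int b\<bar>) * exp (- (pi * v) * \<bar>of_int c\<bar>)"
      by (simp add: exp_add[symmetric] algebra_simps)
    then have "I_fun v s b c * ?e \<le> (4 * pi * sqrt v * \<bar>of_int b * of_int c\<bar>)
        * (exp (- (pi * v) * \<bar>of_int b\<bar>) * exp (- (pi * v) * \<bar>of_int c\<bar>))"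
      using v s by (intro mult_mono I_fun_le) auto
    then show ?thesis by (simp add: abs_mult mult_ac)
  next
    case False
    then show ?thesis using v by (simp add: I_fun_def)
  qed
  have B0: "B_fun v s b c \<ge> 0"
    unfolding B_fun_eq_tail_kernel by (rule tail_kernel_nonneg)
  have "norm (of_real (xi_check v z b c) * exp (2 * pi * \<i> * \<tau>) powi (- b * c)) = \<bar>xi_check v z b c\<bar> * ?e"
    by (simp only: norm_mult norm_of_real q)
  also have "\<bar>xi_check v z b c\<bar> = t_coord z / sqrt v * \<bar>B_fun v s b c - I_fun v s b c\<bar>"
    using v t by (simp add: xi_check_def abs_mult s_def)
  also have "t_coord z / sqrt v * \<bar>B_fun v s b c - I_fun v s b c\<bar> * ?e
      = t_coord z / sqrt v * (\<bar>B_fun v s b c - I_fun v s b c\<bar> * ?e)"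
    by (simp only: mult.assoc)
  also have "\<dots> \<le> t_coord z / sqrt v * ((B_fun v s b c + I_fun v s b c) * ?e)"
    using v t B0 I_fun_nonneg[OF v, of s b c] by (intro mult_left_mono mult_right_mono) auto
  also have "\<dots> \<le> t_coord z / sqrt v *
       (2 * (exp (- pi * (sqrt v / s * of_int b)\<^sup>2) * exp (- pi * (sqrt v * s * of_int c)\<^sup>2))
        + 4 * pi * sqrt v * ((\<bar>of_int b\<bar> * exp (- (pi * v) * \<bar>of_int b\<bar>)) * (\<bar>of_int c\<bar> * exp (- (pi * v) * \<bar>of_int c\<bar>))))"
    unfolding distrib_right using B I v t by (intro mult_left_mono add_mono) auto
  finally show ?thesis .
qed

text \<open>Indexing by pairs instead of by \<open>m\<close> exposes the lattice structure; the
  factor 1/2 of \<open>Xi_check\<close> is left outside.\<close>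

definition boundary_term :: "complex \<Rightarrow> complex \<times> complex \<Rightarrow> int \<times> int \<Rightarrow> complex" where
  "boundary_term \<tau> z = (\<lambda>(b, c). of_real (xi_check (Im \<tau>) z b c) * exp (2 * pi * \<i> * \<tau>) powi (- b * c))"

text \<open>\<open>K\<close> is uniform in \<open>z\<close>: the Gaussian double sum is at most
  \<open>1 / v\<close> because \<open>s\<close> cancels between its factors, and the sum
  \<open>H\<close> majorising the \<open>I_fun\<close> part involves only \<open>v\<close>.\<close>

lemma boundary_term_off_axes:
  assumes \<tau>: "Im \<tau> > 0"
  obtains K where "\<And>z. z \<in> upper_half_plane \<times> upper_half_plane \<Longrightarrow>
    \<exists>S. (boundary_term \<tau> z has_sum S) ((- {0}) \<times> (- {0})) \<and> norm S \<le> K * t_coord z"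
proof -
  define v where "v = Im \<tau>"
  have v: "v > 0" using \<tau> by (simp add: v_def)
  define h where "h = (\<lambda>c::int. \<bar>of_int c\<bar> * exp (- (pi * v) * \<bar>of_int c\<bar>))"
  obtain H where H: "(h has_sum H) (- {0})"
    using summable_on_abs_exp_int[of "pi * v"] v by (auto simp: summable_on_def h_def)
  have h0: "h c \<ge> 0" for c by (simp add: h_def)
  define K where "K = 1 / sqrt v * (2 * (1 / v) + 4 * pi * sqrt v * (H * H))"
  show ?thesis
  proof
    fix z assume z: "z \<in> upper_half_plane \<times> upper_half_plane"
    define s where "s = s_coord z"
    have s: "s > 0" and t: "t_coord z > 0"
      using z by (auto simp: s_def s_coord_def t_coord_def upper_half_plane_def)
    define e1 where "e1 = (\<lambda>b::int. exp (- pi * (sqrt v / s * of_int b)\<^sup>2))"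
    define e2 where "e2 = (\<lambda>c::int. exp (- pi * (sqrt v * s * of_int c)\<^sup>2))"
    obtain S1 where S1: "(e1 has_sum S1) (- {0})" "S1 \<le> 1 / (sqrt v / s)"
      unfolding e1_def using v s by (elim gaussian_lattice_sum[rotated]) auto
    obtain S2 where S2: "(e2 has_sum S2) (- {0})" "S2 \<le> 1 / (sqrt v * s)"
      unfolding e2_def using v s by (elim gaussian_lattice_sum[rotated]) auto
    have e0: "e1 b \<ge> 0" "e2 c \<ge> 0" for b c by (auto simp: e1_def e2_def)
    have "0 \<le> S2" using S2(1) by (rule has_sum_nonneg) (simp add: e0)
    then have "S1 * S2 \<le> 1 / (sqrt v / s) * (1 / (sqrt v * s))"
      using S1(2) S2(2) v s by (intro mult_mono) auto
    also have "\<dots> = 1 / v" using v s by simp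
    finally have S12: "S1 * S2 \<le> 1 / v" .
    define G where "G = (\<lambda>p::int \<times> int. t_coord z / sqrt v * (2 * (case p of (b, c) \<Rightarrow> e1 b * e2 c)
        + 4 * pi * sqrt v * (case p of (b, c) \<Rightarrow> h b * h c)))"
    have G: "(G has_sum (t_coord z / sqrt v * (2 * (S1 * S2) + 4 * pi * sqrt v * (H * H)))) ((- {0}) \<times> (- {0}))"
      unfolding G_def
      by (intro has_sum_cmult_right has_sum_add has_sum_times_real S1 S2 H e0 h0)
    have le: "norm (boundary_term \<tau> z p) \<le> G p" if "p \<in> (- {0}) \<times> (- {0})" for p
      using that norm_boundary_term_le[OF \<tau> z]
      by (auto simp: boundary_term_def G_def e1_def e2_def h_def v_def s_def simp del: mult_minus_left)
    have abs: "(\<lambda>p. norm (boundary_term \<tau> z p)) summable_on ((- {0}) \<times> (- {0}))"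
      using G by (intro Infinite_Sum.abs_summable_on_comparison_test'[OF _ le]) (auto simp: summable_on_def)
    let ?S = "infsum (boundary_term \<tau> z) ((- {0}) \<times> (- {0}))"
    have "norm ?S \<le> infsum (\<lambda>p. norm (boundary_term \<tau> z p)) ((- {0}) \<times> (- {0}))"
      by (rule norm_infsum_bound[OF abs])
    also have "\<dots> \<le> t_coord z / sqrt v * (2 * (S1 * S2) + 4 * pi * sqrt v * (H * H))"
      using le by (intro has_sum_mono[OF has_sum_infsum[OF abs] G]) auto
    also have "\<dots> \<le> t_coord z / sqrt v * (2 * (1 / v) + 4 * pi * sqrt v * (H * H))"
      using S12 v t by (intro mult_left_mono add_right_mono) auto
    also have "\<dots> = K * t_coord z" by (simp add: K_def)
    finally have "norm ?S \<le> K * t_coord z" .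
    moreover have "(boundary_term \<tau> z has_sum ?S) ((- {0}) \<times> (- {0}))"
      using abs_summable_summable[OF abs] by simp
    ultimately show "\<exists>S. (boundary_term \<tau> z has_sum S) ((- {0}) \<times> (- {0})) \<and> norm S \<le> K * t_coord z"
      by blast
  qed
qed

text \<open>Here \<open>b * c = 0\<close>, so q^m = 1 and \<open>I_fun\<close> vanishes. Each axis
  is a lattice sum of \<open>tail_kernel\<close> with spacing \<open>sqrt v * s\<close> or
  \<open>sqrt v / s\<close>; the main terms add up to twice the correction term of
  \<open>Xi_check_plus\<close>.\<close>

lemma boundary_term_axes:
  assumes \<tau>: "Im \<tau> > 0" and z: "z \<in> upper_half_plane \<times> upper_half_plane"
  obtains S where "(boundary_term \<tau> z has_sum of_real S) (({0} \<times> UNIV) \<union> ((- {0}) \<times> {0}))"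
    "\<bar>S - 1 / Im \<tau> * t_coord z * (s_coord z + 1 / s_coord z)\<bar> \<le> 10 / sqrt (Im \<tau>) * t_coord z"
proof -
  define v s where "v = Im \<tau>" and "s = s_coord z"
  define k where "k = t_coord z / sqrt v"
  have v: "v > 0" and s: "s > 0" and t: "t_coord z > 0"
    using \<tau> z by (auto simp: v_def s_def s_coord_def t_coord_def upper_half_plane_def)
  have k: "k > 0" using v t by (simp add: k_def)
  obtain S1 where S1: "((\<lambda>c::int. tail_kernel ((sqrt v * s * of_int c)\<^sup>2)) has_sum S1) (- {0})"
      "\<bar>S1 - 1 / (sqrt v * s)\<bar> \<le> 4"
    using v s by (elim tail_kernel_lattice_sum[rotated]) auto
  obtain S2 where S2: "((\<lambda>b::int. tail_kernel ((sqrt v / s * of_int b)\<^sup>2)) has_sum S2) (- {0})"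
      "\<bar>S2 - 1 / (sqrt v / s)\<bar> \<le> 4"
    using v s by (elim tail_kernel_lattice_sum[rotated]) auto
  have val_c: "boundary_term \<tau> z (0, c) = of_real (k * tail_kernel ((sqrt v * s * of_int c)\<^sup>2))" for c
    using v by (simp add: boundary_term_def xi_check_def B_fun_eq_tail_kernel I_fun_def k_def v_def s_def
        power_mult_distrib mult_ac)
  have val_b: "boundary_term \<tau> z (b, 0) = of_real (k * tail_kernel ((sqrt v / s * of_int b)\<^sup>2))" for b
    using v by (simp add: boundary_term_def xi_check_def B_fun_eq_tail_kernel I_fun_def k_def v_def s_def
        power_mult_distrib power_divide mult_ac)
  have "((\<lambda>c. boundary_term \<tau> z (0, c)) has_sum of_real (k * S1)) (- {0})"
    unfolding val_c by (intro has_sum_of_real has_sum_cmult_right S1)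
  then have c: "(boundary_term \<tau> z has_sum of_real (k * S1)) ({0} \<times> (- {0}))"
    by (rule has_sum_reindex_bij_witness[of _ snd "\<lambda>c. (0, c)", THEN iffD1, rotated -1]) auto
  have "((\<lambda>b. boundary_term \<tau> z (b, 0)) has_sum of_real (k * S2)) (- {0})"
    unfolding val_b by (intro has_sum_of_real has_sum_cmult_right S2)
  then have b: "(boundary_term \<tau> z has_sum of_real (k * S2)) ((- {0}) \<times> {0})"
    by (rule has_sum_reindex_bij_witness[of _ fst "\<lambda>b. (b, 0)", THEN iffD1, rotated -1]) auto
  have o: "(boundary_term \<tau> z has_sum of_real (k * 2)) {(0, 0)}"
    using val_c[of 0] by (intro has_sum_finiteI) (auto simp: tail_kernel_zero)
  have "(boundary_term \<tau> z has_sum (of_real (k * 2) + of_real (k * S1) + of_real (k * S2)))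
      ({(0, 0)} \<union> {0} \<times> (- {0}) \<union> (- {0}) \<times> {0})"
    by (intro has_sum_Un_disjoint o b c) auto
  also have "{(0::int, 0::int)} \<union> {0} \<times> (- {0}) \<union> (- {0}) \<times> {0} = ({0} \<times> UNIV) \<union> ((- {0}) \<times> {0})"
    by auto
  finally have sum: "(boundary_term \<tau> z has_sum of_real (k * (2 + S1 + S2))) (({0} \<times> UNIV) \<union> ((- {0}) \<times> {0}))"
    by (simp add: algebra_simps)
  have "1 / v * t_coord z * (s + 1 / s) = k * (1 / (sqrt v * s) + 1 / (sqrt v / s))"
    using v s by (simp add: k_def field_simps)
  then have "\<bar>k * (2 + S1 + S2) - 1 / v * t_coord z * (s + 1 / s)\<bar>
      = \<bar>k * (2 + (S1 - 1 / (sqrt v * s)) + (S2 - 1 / (sqrt v / s)))\<bar>"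
    by (simp add: algebra_simps)
  also have "\<dots> = k * \<bar>2 + (S1 - 1 / (sqrt v * s)) + (S2 - 1 / (sqrt v / s))\<bar>"
    using k by (simp add: abs_mult)
  \<comment> \<open>The 10 consists of 2 from the origin and an error of 4 from each axis.\<close>
  also have "\<dots> \<le> k * 10"
    using k S1(2) S2(2) by (intro mult_left_mono) linarith+
  also have "k * 10 = 10 / sqrt v * t_coord z"
    by (simp add: k_def)
  finally show thesis
    using that[OF sum] by (simp only: v_def s_def)
qed

section \<open>Regrouping the q-series into a sum over all integer pairs\<close>

lemma infsum_complex_of_real: "infsum (\<lambda>x. complex_of_real (f x)) A = of_real (infsum f A)"
proof (cases "f summable_on A")
  case True
  then show ?thesis by (intro infsumI has_sum_of_real has_sum_infsum)
next
  case False
  then have "\<not> (\<lambda>x. complex_of_real (f x)) summable_on A"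
    using summable_on_Re[of "\<lambda>x. complex_of_real (f x)" A] by auto
  \<comment> \<open>A sum that does not converge has the default value 0, on both sides.\<close>
  then show ?thesis using False by (simp add: infsum_not_exists)
qed

text \<open>Every pair lies on exactly one fibre \<open>- b * c = m\<close>, so summability over all
  pairs permits summation fibre by fibre, including the infinite fibre over
  \<open>m = 0\<close>.\<close>

lemma Xi_check_plus_eq_infsum:
  assumes "boundary_term \<tau> z summable_on UNIV"
  shows "Xi_check_plus \<tau> z = 1 / 2 * (\<Sum>\<^sub>\<infinity>p. boundary_term \<tau> z p)
    - of_real (1 / (2 * Im \<tau>) * t_coord z * (s_coord z + 1 / s_coord z))"
proof -
  let ?q = "exp (2 * pi * \<i> * \<tau>)"
  let ?F = "\<lambda>m::int. {(b, c). - b * c = m}"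
  have inner: "of_real (Xi_check (Im \<tau>) z m) * ?q powi m = 1 / 2 * (\<Sum>\<^sub>\<infinity>p\<in>?F m. boundary_term \<tau> z p)" for m
  proof -
    have "(\<Sum>\<^sub>\<infinity>p\<in>?F m. boundary_term \<tau> z p)
        = (\<Sum>\<^sub>\<infinity>p\<in>?F m. of_real (case p of (b, c) \<Rightarrow> xi_check (Im \<tau>) z b c) * ?q powi m)"
      by (intro infsum_cong) (auto simp: boundary_term_def)
    also have "\<dots> = (\<Sum>\<^sub>\<infinity>p\<in>?F m. of_real (case p of (b, c) \<Rightarrow> xi_check (Im \<tau>) z b c)) * ?q powi m"
      by (rule infsum_cmult_left') 
    also have "(\<Sum>\<^sub>\<infinity>p\<in>?F m. of_real (case p of (b, c) \<Rightarrow> xi_check (Im \<tau>) z b c))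
        = complex_of_real (\<Sum>\<^sub>\<infinity>p\<in>?F m. case p of (b, c) \<Rightarrow> xi_check (Im \<tau>) z b c)"
      by (rule infsum_complex_of_real)
    finally show ?thesis by (simp add: Xi_check_def)
  qed
  have bij: "bij_betw snd (Sigma UNIV ?F) UNIV"
    by (rule bij_betwI[where g = "\<lambda>p. (- fst p * snd p, p)"]) auto
  have "(\<Sum>\<^sub>\<infinity>m. of_real (Xi_check (Im \<tau>) z m) * ?q powi m)
      = 1 / 2 * (\<Sum>\<^sub>\<infinity>m. \<Sum>\<^sub>\<infinity>p\<in>?F m. boundary_term \<tau> z p)"
    unfolding inner by (rule infsum_cmult_right')
  also have "(\<Sum>\<^sub>\<infinity>m. \<Sum>\<^sub>\<infinity>p\<in>?F m. boundary_term \<tau> z p) = (\<Sum>\<^sub>\<infinity>(m, p)\<in>Sigma UNIV ?F. boundary_term \<tau> z p)"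
    using summable_on_reindex_bij_betw[OF bij, of "boundary_term \<tau> z"] assms
    by (intro infsum_Sigma'_banach) (auto simp: case_prod_unfold)
  also have "\<dots> = (\<Sum>\<^sub>\<infinity>p. boundary_term \<tau> z p)"
    using infsum_reindex_bij_betw[OF bij, of "boundary_term \<tau> z"] by (simp add: case_prod_unfold)
  finally show ?thesis by (simp add: Xi_check_plus_def)
qed

text \<open>The axes and their complement partition the index set. Half the main term of the axes is
  the subtracted correction, so only two contributions of size O(t) survive.\<close>

lemma Xi_check_plus_bound:
  assumes \<tau>: "Im \<tau> > 0"
  obtains K where "\<And>z. z \<in> upper_half_plane \<times> upper_half_plane \<Longrightarrow>
    boundary_term \<tau> z summable_on UNIV \<and> norm (Xi_check_plus \<tau> z) \<le> K * t_coord z"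
proof -
  obtain K where K: "\<And>z. z \<in> upper_half_plane \<times> upper_half_plane \<Longrightarrow>
      \<exists>S. (boundary_term \<tau> z has_sum S) ((- {0}) \<times> (- {0})) \<and> norm S \<le> K * t_coord z"
    using boundary_term_off_axes[OF \<tau>] by blast
  show thesis
  proof (rule that[of "1 / 2 * K + 1 / 2 * (10 / sqrt (Im \<tau>))"])
    fix z assume z: "z \<in> upper_half_plane \<times> upper_half_plane"
    obtain S where S: "(boundary_term \<tau> z has_sum S) ((- {0}) \<times> (- {0}))" "norm S \<le> K * t_coord z"
      using K[OF z] by blast
    obtain A where A: "(boundary_term \<tau> z has_sum of_real A) (({0} \<times> UNIV) \<union> ((- {0}) \<times> {0}))"
        "\<bar>A - 1 / Im \<tau> * t_coord z * (s_coord z + 1 / s_coord z)\<bar> \<le> 10 / sqrt (Im \<tau>) * t_coord z"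
      using boundary_term_axes[OF \<tau> z] by blast
    have "(boundary_term \<tau> z has_sum (S + of_real A))
        (((- {0}) \<times> (- {0})) \<union> (({0} \<times> UNIV) \<union> ((- {0}) \<times> {0})))"
      by (intro has_sum_Un_disjoint S A) auto
    also have "((- {0}) \<times> (- {0})) \<union> (({0} \<times> UNIV) \<union> ((- {0}) \<times> {0})) = (UNIV :: (int \<times> int) set)"
      by auto
    finally have sum: "(boundary_term \<tau> z has_sum (S + of_real A)) UNIV" .
    then have summ: "boundary_term \<tau> z summable_on UNIV" by (auto simp: summable_on_def)
    have "Xi_check_plus \<tau> z = 1 / 2 * (S + of_real A)
        - of_real (1 / (2 * Im \<tau>) * t_coord z * (s_coord z + 1 / s_coord z))"
      unfolding Xi_check_plus_eq_infsum[OF summ] infsumI[OF sum] by simp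
    also have "1 / (2 * Im \<tau>) * t_coord z * (s_coord z + 1 / s_coord z)
        = 1 / 2 * (1 / Im \<tau> * t_coord z * (s_coord z + 1 / s_coord z))"
      by simp
    also have "1 / 2 * (S + of_real A) - of_real \<dots> = 1 / 2 * S + of_real (1 / 2 * (A - 1 / Im \<tau> * t_coord z * (s_coord z + 1 / s_coord z)))"
      by (simp only: of_real_mult of_real_diff) (simp add: ring_distribs)
    also have "norm \<dots> \<le> norm (1 / 2 * S) + norm (complex_of_real (1 / 2 * (A - 1 / Im \<tau> * t_coord z * (s_coord z + 1 / s_coord z))))"
      by (rule norm_triangle_ineq)
    also have "\<dots> = 1 / 2 * norm S + 1 / 2 * \<bar>A - 1 / Im \<tau> * t_coord z * (s_coord z + 1 / s_coord z)\<bar>"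
      by (simp only: norm_mult norm_of_real abs_mult norm_divide) simp
    also have "\<dots> \<le> 1 / 2 * (K * t_coord z) + 1 / 2 * (10 / sqrt (Im \<tau>) * t_coord z)"
      using S(2) A(2) by (intro add_mono mult_left_mono) auto
    finally show "boundary_term \<tau> z summable_on UNIV \<and> norm (Xi_check_plus \<tau> z)
        \<le> (1 / 2 * K + 1 / 2 * (10 / sqrt (Im \<tau>))) * t_coord z"
      using summ by (simp add: algebra_simps)
  qed
qed

subsection \<open>Integrability on the fundamental domain\<close>

text \<open>Every finite set of pairs is eventually inside the boxes, so an unordered sum becomes
  the limit of a sequence, the form in which measurability passes to limits.\<close>

lemma filterlim_int_boxes:
  "filterlim (\<lambda>n. {- int n..int n} \<times> {- int n..int n}) (finite_subsets_at_top UNIV) sequentially"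
  unfolding filterlim_finite_subsets_at_top
proof (intro allI impI)
  fix A :: "(int \<times> int) set"
  assume "finite A \<and> A \<subseteq> UNIV"
  then obtain N where N: "\<And>p. p \<in> A \<Longrightarrow> nat \<bar>fst p\<bar> \<le> N \<and> nat \<bar>snd p\<bar> \<le> N"
    using finite_nat_set_iff_bounded_le[of "(\<lambda>p. max (nat \<bar>fst p\<bar>) (nat \<bar>snd p\<bar>)) ` A"] by auto
  show "\<forall>\<^sub>F n in sequentially. finite ({- int n..int n} \<times> {- int n..int n}) \<and>
      A \<subseteq> {- int n..int n} \<times> {- int n..int n} \<and> {- int n..int n} \<times> {- int n..int n} \<subseteq> UNIV"
    using eventually_ge_at_top[of N]
  proof eventually_elim
    case (elim n)
    have "A \<subseteq> {- int n..int n} \<times> {- int n..int n}"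
    proof
      fix p assume "p \<in> A"
      then show "p \<in> {- int n..int n} \<times> {- int n..int n}"
        using N[of p] elim by (cases p) auto
    qed
    then show ?case by auto
  qed
qed

lemma borel_measurable_Im_fst_snd [measurable]:
  "(\<lambda>z :: complex \<times> complex. Im (fst z)) \<in> borel_measurable borel"
  "(\<lambda>z :: complex \<times> complex. Im (snd z)) \<in> borel_measurable borel"
  by (intro borel_measurable_continuous_onI continuous_intros)+

lemma borel_measurable_st_coord [measurable]:
  "t_coord \<in> borel_measurable borel" "s_coord \<in> borel_measurable borel"
  unfolding t_coord_def s_coord_def by measurable

lemma borel_measurable_boundary_term [measurable]: "(\<lambda>z. boundary_term \<tau> z p) \<in> borel_measurable borel"
proof (cases p)
  case (Pair b c)
  \<comment> \<open>The branch of \<open>I_fun\<close> is decided by \<open>b\<close> and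
    \<open>c\<close> and hence is constant in \<open>z\<close>.\<close>
  have "(\<lambda>z. I_fun (Im \<tau>) (s_coord z) b c) \<in> borel_measurable borel"
    unfolding I_fun_def by (cases "- b * c > 0") simp_all
  then show ?thesis
    unfolding Pair boundary_term_def xi_check_def B_fun_eq_tail_kernel by simp
qed

section \<open>The fundamental domain and its measure\<close>

lemma fundamental_domain_subset: "fundamental_domain \<subseteq> upper_half_plane"
  by (auto simp: fundamental_domain_def)

text \<open>Otherwise |z|^2 would be at most 1/4 + 1/4 < 1. The value 1/2, weaker than the sharp
  sqrt 3 / 2, suits the boxes of height 1/2 used below.\<close>

lemma fundamental_domain_Im:
  assumes "z \<in> fundamental_domain"
  shows "Im z > 1 / 2"
proof (rule ccontr)
  assume "\<not> Im z > 1 / 2"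
  then have "(Im z)\<^sup>2 \<le> (1 / 2)\<^sup>2" "\<bar>Re z\<bar>\<^sup>2 \<le> (1 / 2)\<^sup>2"
    using assms by (intro power_mono; auto simp: fundamental_domain_def upper_half_plane_def)+
  moreover have "1 \<le> (Re z)\<^sup>2 + (Im z)\<^sup>2"
    using assms by (simp add: fundamental_domain_def norm_complex_def)
  ultimately show False by (simp add: power2_eq_square)
qed

lemma sets_fundamental_domain [measurable]: "fundamental_domain \<in> sets borel"
proof -
  have "{z :: complex. 0 < Im z \<and> \<bar>Re z\<bar> \<le> 1 / 2 \<and> 1 \<le> norm z} \<in> sets borel"
    by measurable
  then show ?thesis by (simp add: fundamental_domain_def upper_half_plane_def)
qed

lemma sets_fundamental_domain_Times: "fundamental_domain \<times> fundamental_domain \<in> sets borel"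
  by (subst borel_prod[symmetric]) (intro pair_measureI sets_fundamental_domain)

lemma space_c1_L_squared: "space c1_L_squared = fundamental_domain \<times> fundamental_domain"
  by (simp add: c1_L_squared_def space_restrict_space)

lemma sets_c1_L_squared:
  "sets c1_L_squared = sets (restrict_space borel (fundamental_domain \<times> fundamental_domain))"
  unfolding c1_L_squared_def sets_density by (intro sets_restrict_space_cong) simp

lemma borel_measurable_c1_L_squared:
  assumes "f \<in> borel_measurable borel"
  shows "f \<in> borel_measurable c1_L_squared"
  using measurable_restrict_space1[OF assms] by (simp add: measurable_cong_sets[OF sets_c1_L_squared refl])

text \<open>It is a pointwise limit of finite sums over boxes. Convergence is known on the product
  of upper half-planes, which contains the space of \<open>c1_L_squared\<close>.\<close>

lemma Xi_check_plus_measurable: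
  assumes "Im \<tau> > 0"
  shows "(\<lambda>z. Xi_check_plus \<tau> z) \<in> borel_measurable c1_L_squared"
proof -
  obtain K where K: "\<And>z. z \<in> upper_half_plane \<times> upper_half_plane \<Longrightarrow>
      boundary_term \<tau> z summable_on UNIV \<and> norm (Xi_check_plus \<tau> z) \<le> K * t_coord z"
    using Xi_check_plus_bound[OF assms] by blast
  let ?u = "\<lambda>n z. 1 / 2 * (\<Sum>p\<in>{- int n..int n} \<times> {- int n..int n}. boundary_term \<tau> z p)
      - of_real (1 / (2 * Im \<tau>) * t_coord z * (s_coord z + 1 / s_coord z))"
  show ?thesis
  proof (rule borel_measurable_LIMSEQ_metric)
    show "?u n \<in> borel_measurable c1_L_squared" for n
      by (intro borel_measurable_c1_L_squared) measurable
    fix z assume "z \<in> space c1_L_squared"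
    then have "boundary_term \<tau> z summable_on UNIV"
      using fundamental_domain_subset by (intro K[THEN conjunct1]) (auto simp: space_c1_L_squared)
    moreover from this have "(\<lambda>n. \<Sum>p\<in>{- int n..int n} \<times> {- int n..int n}. boundary_term \<tau> z p)
        \<longlonglongrightarrow> (\<Sum>\<^sub>\<infinity>p. boundary_term \<tau> z p)"
      using filterlim_compose[OF _ filterlim_int_boxes] has_sum_infsum unfolding has_sum_def by blast
    ultimately show "(\<lambda>n. ?u n z) \<longlonglongrightarrow> Xi_check_plus \<tau> z"
      by (subst Xi_check_plus_eq_infsum) (auto intro!: tendsto_intros)
  qed
qed

text \<open>The integrand is y^(-3/2), with exponent below -1. The boxes \<open>J k\<close> of area
  1/2 cover the domain, and \<open>a k\<close> is the value on the bottom edge of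
  \<open>J k\<close>; shared edges are harmless for an upper bound.\<close>

lemma nn_integral_fundamental_domain:
  "(\<integral>\<^sup>+z. ennreal (sqrt (Im z) / (Im z)\<^sup>2) * indicator fundamental_domain z \<partial>lborel) < \<infinity>"
proof -
  define J where "J = (\<lambda>k::nat. cbox (Complex (- 1 / 2) (real (Suc k) / 2)) (Complex (1 / 2) (real (Suc k) / 2 + 1 / 2)))"
  define a where "a = (\<lambda>k::nat. (real (Suc k) / 2) powr (- 3 / 2))"
  have J: "emeasure lborel (J k) = ennreal (1 / 2)" for k
    unfolding J_def by (subst emeasure_lborel_cbox_eq) (auto simp: Basis_complex_def)
  have [measurable]: "J k \<in> sets borel" for k by (simp add: J_def)
  have "summable (\<lambda>k. real (Suc k) powr (- 3 / 2))"
    by (subst summable_Suc_iff) (simp add: summable_real_powr_iff)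
  then have sm: "summable a"
    unfolding a_def by (simp add: powr_divide summable_divide)
  have "(\<integral>\<^sup>+z. ennreal (sqrt (Im z) / (Im z)\<^sup>2) * indicator fundamental_domain z \<partial>lborel)
      \<le> (\<integral>\<^sup>+z. (\<Sum>k. ennreal (a k) * indicator (J k) z) \<partial>lborel)"
  proof (intro nn_integral_mono)
    fix z :: complex
    show "ennreal (sqrt (Im z) / (Im z)\<^sup>2) * indicator fundamental_domain z \<le> (\<Sum>k. ennreal (a k) * indicator (J k) z)"
    proof (cases "z \<in> fundamental_domain")
      case True
      then have y: "Im z > 1 / 2" by (rule fundamental_domain_Im)
      \<comment> \<open>\<open>J k\<close> starts at height (k + 1) / 2, so k + 1 must be the floor
        of \<open>2 * Im z\<close>. As \<open>Im z > 1 / 2\<close>, this floor is at least 1 and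
        \<open>nat\<close> does not truncate.\<close>
      define k where "k = nat (\<lfloor>2 * Im z\<rfloor> - 1)"
      have "\<lfloor>2 * Im z\<rfloor> \<ge> 1" using y by linarith
      then have "real (Suc k) = of_int \<lfloor>2 * Im z\<rfloor>" by (simp add: k_def)
      then have "real (Suc k) \<le> 2 * Im z" "2 * Im z \<le> real (Suc k) + 1"
        using of_int_floor_le[of "2 * Im z"] real_of_int_floor_add_one_ge[of "2 * Im z"]
        by (simp_all only:)
      then have k: "real (Suc k) / 2 \<le> Im z" "Im z \<le> real (Suc k) / 2 + 1 / 2"
        by (simp_all add: field_simps)
      have "z \<in> J k"
        using True k by (auto simp: J_def in_cbox_complex_iff fundamental_domain_def)
      have "sqrt (Im z) / (Im z)\<^sup>2 = Im z powr (1 / 2) * Im z powr (- 2)"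
        using y by (simp add: powr_half_sqrt powr_minus powr_numeral field_simps)
      also have "\<dots> = Im z powr (- 3 / 2)" by (simp add: powr_add[symmetric])
      also have "\<dots> \<le> a k"
        unfolding a_def using k by (intro powr_mono2') auto
      finally have "ennreal (sqrt (Im z) / (Im z)\<^sup>2) * indicator fundamental_domain z \<le> ennreal (a k) * indicator (J k) z"
        using True \<open>z \<in> J k\<close> by (simp add: ennreal_leI)
      also have "\<dots> \<le> (\<Sum>k. ennreal (a k) * indicator (J k) z)"
        using sum_le_suminf[of "\<lambda>k. ennreal (a k) * indicator (J k) z" "{k}"]
        by (simp only: sum.insert finite.emptyI empty_iff not_False_eq_True sum.empty add_0_right) auto
      finally show ?thesis .
    qed auto
  qed
  also have "\<dots> = (\<Sum>k. ennreal (a k) * ennreal (1 / 2))"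
    by (subst nn_integral_suminf) (auto simp: nn_integral_cmult_indicator J simp del: ennreal_half)
  also have "\<dots> = (\<Sum>k. ennreal (a k)) * ennreal (1 / 2)"
    by (rule ennreal_suminf_multc)
  also have "(\<Sum>k. ennreal (a k)) = ennreal (\<Sum>k. a k)"
    by (intro suminf_ennreal2 sm) (simp add: a_def)
  also have "ennreal (\<Sum>k. a k) * ennreal (1 / 2) < \<infinity>"
    by (subst ennreal_mult''[symmetric]) simp_all
  finally show ?thesis .
qed

text \<open>Together with the density, \<open>t_coord\<close> factors into y_1^(-3/2) y_2^(-3/2) up
  to a constant, so Tonelli reduces the claim to the square of the one-variable integral.\<close>

lemma integrable_t_coord: "integrable c1_L_squared t_coord"
proof (rule integrableI_bounded)
  have ennreal_mult3: "ennreal (x * (x' * x'')) = ennreal x * (ennreal x' * ennreal x'')"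
    if "0 \<le> x" "0 \<le> x'" "0 \<le> x''" for x x' x'' :: real
    using that by (simp add: ennreal_mult)
  let ?F = "fundamental_domain"
  let ?\<phi> = "\<lambda>z. ennreal (sqrt (Im z) / (Im z)\<^sup>2) * indicator ?F z"
  let ?d = "\<lambda>(z1, z2). ennreal (18 / pi\<^sup>2 * (1 / (Im z1)\<^sup>2) * (1 / (Im z2)\<^sup>2))"
  show "t_coord \<in> borel_measurable c1_L_squared"
    by (intro borel_measurable_c1_L_squared) measurable
  have FF: "?F \<times> ?F \<inter> space lborel \<in> sets lborel"
    using sets_fundamental_domain_Times by simp
  have d[measurable]: "?d \<in> borel_measurable borel"
    by (simp add: case_prod_unfold)
  have "(\<integral>\<^sup>+z. ennreal (norm (t_coord z)) \<partial>c1_L_squared)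
      = (\<integral>\<^sup>+z. ?d z * ennreal (norm (t_coord z)) \<partial>restrict_space lborel (?F \<times> ?F))"
    unfolding c1_L_squared_def
    by (intro nn_integral_density measurable_restrict_space1) simp_all
  also have "\<dots> = (\<integral>\<^sup>+z. ?d z * ennreal (norm (t_coord z)) * indicator (?F \<times> ?F) z \<partial>lborel)"
    by (rule nn_integral_restrict_space[OF FF])
  also have "\<dots> = (\<integral>\<^sup>+z. ennreal (18 / pi\<^sup>2) * (?\<phi> (fst z) * ?\<phi> (snd z)) \<partial>(lborel \<Otimes>\<^sub>M lborel))"
    unfolding lborel_prod
  proof (intro nn_integral_cong)
    fix z :: "complex \<times> complex"
    obtain z1 z2 where z: "z = (z1, z2)" by (cases z)
    show "?d z * ennreal (norm (t_coord z)) * indicator (?F \<times> ?F) z = ennreal (18 / pi\<^sup>2) * (?\<phi> (fst z) * ?\<phi> (snd z))"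
    proof (cases "z1 \<in> ?F \<and> z2 \<in> ?F")
      case True
      then have y: "Im z1 > 0" "Im z2 > 0"
        using fundamental_domain_subset by (auto simp: upper_half_plane_def)
      have "?d z * ennreal (norm (t_coord z))
          = ennreal (18 / pi\<^sup>2 * (1 / (Im z1)\<^sup>2) * (1 / (Im z2)\<^sup>2) * sqrt (Im z1 * Im z2))"
        using y unfolding z prod.case by (subst ennreal_mult[symmetric]) (auto simp: t_coord_def)
      also have "18 / pi\<^sup>2 * (1 / (Im z1)\<^sup>2) * (1 / (Im z2)\<^sup>2) * sqrt (Im z1 * Im z2)
          = 18 / pi\<^sup>2 * ((sqrt (Im z1) / (Im z1)\<^sup>2) * (sqrt (Im z2) / (Im z2)\<^sup>2))"
        by (simp add: real_sqrt_mult)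
      also have "ennreal \<dots> = ennreal (18 / pi\<^sup>2) * (ennreal (sqrt (Im z1) / (Im z1)\<^sup>2) * ennreal (sqrt (Im z2) / (Im z2)\<^sup>2))"
        using y by (intro ennreal_mult3) auto
      finally show ?thesis using True by (simp add: z)
    qed (auto simp: z)
  qed
  also have "\<dots> = ennreal (18 / pi\<^sup>2) * (\<integral>\<^sup>+z. ?\<phi> (fst z) * ?\<phi> (snd z) \<partial>(lborel \<Otimes>\<^sub>M lborel))"
    by (rule nn_integral_cmult) measurable
  also have "(\<integral>\<^sup>+z. ?\<phi> (fst z) * ?\<phi> (snd z) \<partial>(lborel \<Otimes>\<^sub>M lborel))
      = (\<integral>\<^sup>+z1. (\<integral>\<^sup>+z2. ?\<phi> z1 * ?\<phi> z2 \<partial>lborel) \<partial>lborel)"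
    by (subst lborel.nn_integral_fst[symmetric]) simp_all
  also have "\<dots> = (\<integral>\<^sup>+z1. ?\<phi> z1 * (\<integral>\<^sup>+z2. ?\<phi> z2 \<partial>lborel) \<partial>lborel)"
    by (intro nn_integral_cong nn_integral_cmult) measurable
  also have "\<dots> = (\<integral>\<^sup>+z1. ?\<phi> z1 \<partial>lborel) * (\<integral>\<^sup>+z2. ?\<phi> z2 \<partial>lborel)"
    by (rule nn_integral_multc) measurable
  also have "ennreal (18 / pi\<^sup>2) * \<dots> < \<infinity>"
    using nn_integral_fundamental_domain by (simp add: ennreal_mult_less_top)
  finally show "(\<integral>\<^sup>+z. ennreal (norm (t_coord z)) \<partial>c1_L_squared) < \<infinity>" .
qed

subsection \<open>Continuity of the cut-off function\<close>

lemma int_linear_form_bound: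
  assumes z: "Im z > 0" and le: "norm (of_int a * z + of_int b) \<le> R"
  shows "\<bar>of_int a\<bar> \<le> R / Im z" "\<bar>of_int b\<bar> \<le> R + R / Im z * \<bar>Re z\<bar>"
proof -
  have "\<bar>of_int a * Im z\<bar> \<le> R"
    using abs_Im_le_cmod[of "of_int a * z + of_int b"] le by simp
  then show a: "\<bar>of_int a\<bar> \<le> R / Im z"
    using z by (simp add: abs_mult field_simps)
  have "\<bar>of_int a * Re z + of_int b\<bar> \<le> R"
    using abs_Re_le_cmod[of "of_int a * z + of_int b"] le by simp
  moreover have "\<bar>of_int a * Re z\<bar> \<le> R / Im z * \<bar>Re z\<bar>"
    unfolding abs_mult using a by (intro mult_right_mono) auto
  ultimately show "\<bar>of_int b\<bar> \<le> R + R / Im z * \<bar>Re z\<bar>"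
    by linarith
qed

text \<open>For numerator n and denominator m, the imaginary part of n times the conjugate of m is
  the determinant times Im z; since n = z m, it is also Im z times |m|^2.\<close>

lemma norm_denominator_stabiliser:
  fixes a b c d :: int
  assumes z: "Im z > 0" and det: "a * d - b * c = 1"
    and stab: "(of_int a * z + of_int b) / (of_int c * z + of_int d) = z"
  shows "norm (of_int c * z + of_int d) = 1" "norm (of_int a * z + of_int b) = norm z"
proof -
  let ?n = "of_int a * z + of_int b" and ?m = "of_int c * z + of_int d"
  \<comment> \<open>A vanishing denominator would make the quotient 0 by convention, contradicting
    \<open>Im z > 0\<close>.\<close>
  have "?m \<noteq> 0" using stab z by auto
  then have eq: "?n = z * ?m" using stab by (simp add: field_simps)
  have "Im (?n * cnj ?m) = of_int (a * d - b * c) * Im z"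
    by (simp add: algebra_simps)
  also have "\<dots> = Im z" using det by simp
  finally have "Im (?n * cnj ?m) = Im z" .
  moreover have "?n * cnj ?m = z * of_real ((norm ?m)\<^sup>2)"
    unfolding eq mult.assoc complex_norm_square[symmetric] ..
  ultimately have "Im (z * of_real ((norm ?m)\<^sup>2)) = Im z"
    by (simp only:)
  then have "Im z * (norm ?m)\<^sup>2 = Im z"
    by (simp only: times_complex.sel Re_complex_of_real Im_complex_of_real mult_zero_right add_0)
  then have "(norm ?m)\<^sup>2 = 1" using z by simp
  then show "norm ?m = 1" by (intro power2_eq_imp_eq[of _ 1]) auto
  then show "norm ?n = norm z" by (simp only: eq norm_mult mult_1_right)
qed

text \<open>\<open>card\<close> of an infinite set is 0, so finiteness comes first; the identity and
  its negative then give at least 2 elements, which survives \<open>div 2\<close>. A positive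
  exponent makes the local coordinate vanish at its centre, whereas 0 ^ 0 = 1.\<close>

lemma stab_order_pos:
  assumes "z \<in> upper_half_plane"
  shows "stab_order z > 0"
proof -
  have z: "Im z > 0" using assms by (simp add: upper_half_plane_def)
  let ?S = "{(a :: int, b :: int, c :: int, d :: int). a * d - b * c = 1 \<and>
     (of_int a * z + of_int b) / (of_int c * z + of_int d) = z}"
  \<comment> \<open>One bound for both rows of the matrix: the denominator has norm 1 and the
    numerator has norm \<open>norm z\<close>.\<close>
  define R where "R = max 1 (norm z)"
  define N where "N = \<lceil>max (R / Im z) (R + R / Im z * \<bar>Re z\<bar>)\<rceil>"
  have N: "\<bar>a\<bar> \<le> N \<and> \<bar>b\<bar> \<le> N" if "norm (of_int a * z + of_int b) \<le> R" for a b
    using int_linear_form_bound[OF z that] unfolding N_def by linarith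
  have "?S \<subseteq> {- N..N} \<times> {- N..N} \<times> {- N..N} \<times> {- N..N}"
  proof safe
    fix a b c d :: int
    assume "a * d - b * c = 1" "(of_int a * z + of_int b) / (of_int c * z + of_int d) = z"
    note * = norm_denominator_stabiliser[OF z this]
    have "\<bar>a\<bar> \<le> N \<and> \<bar>b\<bar> \<le> N" "\<bar>c\<bar> \<le> N \<and> \<bar>d\<bar> \<le> N"
      using * by (auto intro!: N simp: R_def)
    then show "a \<in> {- N..N}" "b \<in> {- N..N}" "c \<in> {- N..N}" "d \<in> {- N..N}" by auto
  qed
  then have "finite ?S" by (rule finite_subset) auto
  then have "card {(1::int, 0::int, 0::int, 1::int), (- 1, 0, 0, - 1)} \<le> card ?S"
    by (rule card_mono) auto
  then have "2 \<le> card ?S" by simp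
  then show ?thesis unfolding stab_order_def by linarith
qed

text \<open>This supplies the measurability of the cut-off. Near a point, \<open>\<rho>\<close>
  after \<open>proj\<close> equals a smooth \<open>g\<close> after the coordinate map
  \<open>W\<close>, which is continuous there because the denominators in \<open>W\<close> do not
  vanish.\<close>

lemma smooth_on_X_imp_continuous_proj:
  assumes smooth: "smooth_on_X \<rho>"
  shows "continuous_on (upper_half_plane \<times> upper_half_plane) (\<lambda>z. \<rho> (proj z))"
proof (rule continuous_at_imp_continuous_on, rule ballI)
  fix z0 :: "complex \<times> complex"
  let ?H = "upper_half_plane"
  assume "z0 \<in> ?H \<times> ?H"
  then obtain z1 z2 where z0: "z0 = (z1, z2)" and z: "z1 \<in> ?H" "z2 \<in> ?H" by auto
  have "Some z1 \<in> insert None (Some ` ?H)" "Some z2 \<in> insert None (Some ` ?H)"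
    using z by auto
  then obtain \<epsilon> g where \<epsilon>: "\<epsilon> > 0" and g: "smooth_on (ball 0 \<epsilon> \<times> ball 0 \<epsilon>) g"
    and \<rho>: "\<forall>(p1, w1) \<in> local_coord (Some z1). \<forall>(p2, w2) \<in> local_coord (Some z2).
             norm w1 < \<epsilon> \<longrightarrow> norm w2 < \<epsilon> \<longrightarrow> \<rho> (p1, p2) = g (w1, w2)"
    using smooth[unfolded smooth_on_X_def, THEN bspec, THEN bspec] by blast
  define w1 where "w1 = (\<lambda>z. ((z - z1) / (z - cnj z1)) ^ stab_order z1)"
  define w2 where "w2 = (\<lambda>z. ((z - z2) / (z - cnj z2)) ^ stab_order z2)"
  define W where "W = (\<lambda>z. (w1 (fst z), w2 (snd z)))"
  have W0: "W z0 = (0, 0)"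
    using stab_order_pos[OF z(1)] stab_order_pos[OF z(2)] by (simp add: W_def w1_def w2_def z0)
  have "z1 - cnj z1 \<noteq> 0" "z2 - cnj z2 \<noteq> 0"
    using z by (auto simp: complex_eq_iff upper_half_plane_def)
  then have W: "isCont W z0"
    unfolding W_def w1_def w2_def z0 by (intro continuous_intros) auto
  let ?B = "ball (0::complex) \<epsilon> \<times> ball (0::complex) \<epsilon>"
  have oB: "open ?B" by (intro open_Times open_ball)
  have "continuous_on ?B g"
    using g unfolding smooth_on_def by (metis Ck_on.simps(1))
  then have "isCont g (W z0)"
    using oB \<epsilon> by (simp add: continuous_on_eq_continuous_at W0)
  then have gW: "isCont (\<lambda>z. g (W z)) z0"
    using W by (rule isCont_o2[rotated])
  have "(\<lambda>z. W z) \<midarrow>z0\<rightarrow> W z0" using W by (simp add: isCont_def)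
  then have "\<forall>\<^sub>F z in nhds z0. W z \<in> ?B"
    using W oB \<epsilon> W0 unfolding continuous_at tendsto_at_iff_tendsto_nhds
    by (intro topological_tendstoD) auto
  moreover have "\<forall>\<^sub>F z in nhds z0. z \<in> ?H \<times> ?H"
    using \<open>z0 \<in> ?H \<times> ?H\<close>
    by (intro eventually_nhds_in_open open_Times) (auto simp: upper_half_plane_def open_halfspace_Im_gt)
  ultimately have "\<forall>\<^sub>F z in nhds z0. \<rho> (proj z) = g (W z)"
  proof eventually_elim
    case (elim z)
    have "(proj1 (fst z), w1 (fst z)) \<in> local_coord (Some z1)"
      "(proj1 (snd z), w2 (snd z)) \<in> local_coord (Some z2)"
      using elim by (auto simp: w1_def w2_def)
    from \<rho>[THEN bspec, OF this(1)] this(2)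
    have "norm (w1 (fst z)) < \<epsilon> \<longrightarrow> norm (w2 (snd z)) < \<epsilon>
        \<longrightarrow> \<rho> (proj1 (fst z), proj1 (snd z)) = g (w1 (fst z), w2 (snd z))"
      by blast
    then show ?case
      using elim(1) by (simp add: W_def proj_def)
  qed
  then show "isCont (\<lambda>z. \<rho> (proj z)) z0"
    using gW by (simp add: isCont_cong)
qed

subsection \<open>Modularity of the integral\<close>

text \<open>A non-integrable function has Bochner integral 0 by convention, so the equation for
  \<open>f\<close> alone would not express convergence; integrability is therefore asserted beside
  it.\<close>

theorem theoremA:
  fixes \<rho> :: "modular_point \<times> modular_point \<Rightarrow> real"
    and U :: "(modular_point \<times> modular_point) set"
  assumes rho_range: "\<rho> ` topspace X \<subseteq> {0..1}"
    and rho_smooth: "smooth_on_X \<rho>"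
    and rho_near_D: "\<exists>V. openin X V \<and> D \<subseteq> V \<and> (\<forall>p\<in>V. \<rho> p = 1)"
    and U_nbhd: "openin X U" "D \<subseteq> U"
    and rho_supp: "X closure_of {p \<in> topspace X. \<rho> p \<noteq> 0} \<subseteq> U"
    and Xi_modular: "\<And>z. z \<in> upper_half_plane \<times> upper_half_plane \<Longrightarrow>
                       nonhol_modular_form 2 (\<lambda>\<tau>. Xi_check_plus \<tau> z)"
  shows "\<exists>f. nonhol_modular_form 2 f \<and>
           (\<forall>\<tau>\<in>upper_half_plane.
              integrable c1_L_squared (\<lambda>z. of_real (\<rho> (proj z)) * Xi_check_plus \<tau> z) \<and>
              f \<tau> = (\<integral>z. of_real (\<rho> (proj z)) * Xi_check_plus \<tau> z \<partial>c1_L_squared))"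
proof -
  let ?H = "upper_half_plane"
  define f where "f = (\<lambda>\<tau>. \<integral>z. of_real (\<rho> (proj z)) * Xi_check_plus \<tau> z \<partial>c1_L_squared)"
  have in_H: "z \<in> ?H \<times> ?H" if "z \<in> space c1_L_squared" for z
    using that fundamental_domain_subset by (auto simp: space_c1_L_squared)
  have "nonhol_modular_form 2 f"
    unfolding nonhol_modular_form_def
  proof (intro allI impI ballI)
    fix a b c d :: int and \<tau> :: complex
    assume det: "a * d - b * c = 1" and \<tau>: "\<tau> \<in> ?H"
    let ?\<tau>' = "(of_int a * \<tau> + of_int b) / (of_int c * \<tau> + of_int d)"
    have "f ?\<tau>' = (\<integral>z. (of_int c * \<tau> + of_int d)\<^sup>2 * (of_real (\<rho> (proj z)) * Xi_check_plus \<tau> z) \<partial>c1_L_squared)"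
      unfolding f_def
    proof (rule Bochner_Integration.integral_cong[OF refl])
      fix z assume "z \<in> space c1_L_squared"
      then have "Xi_check_plus ?\<tau>' z = (of_int c * \<tau> + of_int d)\<^sup>2 * Xi_check_plus \<tau> z"
        using Xi_modular[OF in_H, unfolded nonhol_modular_form_def, rule_format, OF _ det \<tau>] by simp
      then show "of_real (\<rho> (proj z)) * Xi_check_plus ?\<tau>' z
          = (of_int c * \<tau> + of_int d)\<^sup>2 * (of_real (\<rho> (proj z)) * Xi_check_plus \<tau> z)"
        by simp
    qed
    \<comment> \<open>The automorphy factor is constant in \<open>z\<close>; pulling it out is valid
      in every case, as a divergent integral is 0 on both sides.\<close>
    also have "\<dots> = (of_int c * \<tau> + of_int d)\<^sup>2 * f \<tau>"
      unfolding f_def by (rule integral_mult_right_zero)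
    finally show "f ?\<tau>' = (of_int c * \<tau> + of_int d)\<^sup>2 * f \<tau>" .
  qed
  moreover have "integrable c1_L_squared (\<lambda>z. of_real (\<rho> (proj z)) * Xi_check_plus \<tau> z)"
    if "\<tau> \<in> ?H" for \<tau>
  proof -
    have \<tau>: "Im \<tau> > 0" using that by (simp add: upper_half_plane_def)
    obtain K where K: "\<And>z. z \<in> ?H \<times> ?H \<Longrightarrow> norm (Xi_check_plus \<tau> z) \<le> K * t_coord z"
      using Xi_check_plus_bound[OF \<tau>] by metis
    have "(\<lambda>z. \<rho> (proj z)) \<in> borel_measurable c1_L_squared"
      unfolding measurable_cong_sets[OF sets_c1_L_squared refl]
      by (intro borel_measurable_continuous_on_restrict
          continuous_on_subset[OF smooth_on_X_imp_continuous_proj[OF rho_smooth]] Sigma_mono fundamental_domain_subset)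
    then have meas: "(\<lambda>z. of_real (\<rho> (proj z)) * Xi_check_plus \<tau> z) \<in> borel_measurable c1_L_squared"
      using Xi_check_plus_measurable[OF \<tau>] by simp
    \<comment> \<open>Values of \<open>\<rho>\<close> in [0, 1] preserve the O(t) bound; the
      integrable \<open>K * t_coord z\<close> then dominates.\<close>
    have "norm (of_real (\<rho> (proj z)) * Xi_check_plus \<tau> z) \<le> norm (K * t_coord z)"
      if "z \<in> space c1_L_squared" for z
    proof -
      have zH: "z \<in> ?H \<times> ?H" using that by (rule in_H)
      then have "proj z \<in> topspace X"
        by (auto simp: proj_def X_def topspace_X1 X1_points_def)
      then have "0 \<le> \<rho> (proj z)" "\<rho> (proj z) \<le> 1"
        using rho_range by auto
      then have "norm (of_real (\<rho> (proj z)) * Xi_check_plus \<tau> z) \<le> norm (Xi_check_plus \<tau> z)"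
        by (auto simp: norm_mult intro: mult_left_le_one_le)
      also have "\<dots> \<le> norm (K * t_coord z)"
        using K[OF zH] by simp
      finally show ?thesis .
    qed
    then show ?thesis
      by (intro Bochner_Integration.integrable_bound[OF integrable_mult_right[OF integrable_t_coord, of K] meas] AE_I2)
  qed
  ultimately show ?thesis
    by (intro exI[of _ f]) (auto simp: f_def)
qed

end
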